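(* Let $SD_{16}=\langle X,Y \mid X^8=Y^2=1,\ YXY=X^3\rangle$ be the semidihedral group of order 16. The even integers that occur as integer group determinants of $SD_{16}$ are exactly the multiples of $2^{10}$. The odd integers that occur as integer group determinants of $SD_{16}$ are exactly the integers $n\equiv 1 \pmod 8$ together with those integers $n\equiv 5\pmod 8$ of the form $n=mp^2$ where $m\equiv 5\pmod 8$ is an integer and $p$ is a prime with $p\equiv 3\pmod 8$.
   Context: For a finite group $G$, the group determinant of an element $\sum_{g\in G} a_g g$ of the group ring $\mathbb{Z}[G]$ is $\mathcal{D}_G\left(\sum_{g\in G} a_g g\right)=\det\left(a_{gh^{-1}}\right)_{g,h\in G}$. An integer group determinant of $G$ is a value of $\mathcal{D}_G$ at an element of $\mathbb{Z}[G]$, i.e. with all $a_g\in\mathbb{Z}$. *)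

theory Defs
  imports
    "HOL-Algebra.Group"
    "HOL-Combinatorics.Permutations"
    "HOL-Number_Theory.Number_Theory"
begin

section \<open>Integer group determinants\<close>

text \<open>The library determinant is indexed by a type or by an initial segment of the naturals;
  this is the same Leibniz sum for a square matrix indexed by a finite set.\<close>

definition det_on :: "'i set \<Rightarrow> ('i \<Rightarrow> 'i \<Rightarrow> 'r::comm_ring_1) \<Rightarrow> 'r" where
  "det_on I A = (\<Sum>p | p permutes I. of_int (sign p) * (\<Prod>i\<in>I. A i (p i)))"

text \<open>An element of the integral group ring of a finite group is given by its coefficient function;
  only the values on the carrier matter.\<close>

definition group_det :: "('g, 'm) monoid_scheme \<Rightarrow> ('g \<Rightarrow> int) \<Rightarrow> int" where
  "group_det G a = det_on (carrier G) (\<lambda>g h. a (g \<otimes>\<^bsub>G\<^esub> inv\<^bsub>G\<^esub> h))"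

definition integer_group_determinants :: "('g, 'm) monoid_scheme \<Rightarrow> int set" where
  "integer_group_determinants G = range (group_det G)"

section \<open>Groups given by generators and relations\<close>

text \<open>A letter \<open>(x, True)\<close> stands for the generator \<open>x\<close> and \<open>(x, False)\<close> for its inverse.
  The generators are all elements of the type \<open>'x\<close>.\<close>

type_synonym 'x gword = "('x \<times> bool) list"

inductive word_cong :: "('x gword \<times> 'x gword) set \<Rightarrow> 'x gword \<Rightarrow> 'x gword \<Rightarrow> bool"
  for R :: "('x gword \<times> 'x gword) set" where
  refl: "word_cong R u u"
| sym: "word_cong R u v \<Longrightarrow> word_cong R v u"
| trans: "word_cong R u v \<Longrightarrow> word_cong R v w \<Longrightarrow> word_cong R u w"
| append: "word_cong R u u' \<Longrightarrow> word_cong R v v' \<Longrightarrow> word_cong R (u @ v) (u' @ v')"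
| cancel: "word_cong R [(x, b), (x, \<not> b)] []"
| relation: "(u, v) \<in> R \<Longrightarrow> word_cong R u v"

definition word_class :: "('x gword \<times> 'x gword) set \<Rightarrow> 'x gword \<Rightarrow> 'x gword set" where
  "word_class R u = {v. word_cong R u v}"

definition presented_group :: "('x gword \<times> 'x gword) set \<Rightarrow> 'x gword set monoid" where
  "presented_group R =
    \<lparr>carrier = range (word_class R),
     mult = (\<lambda>A B. \<Union>u\<in>A. \<Union>v\<in>B. word_class R (u @ v)),
     one = word_class R []\<rparr>"

lemma word_class_eq_iff: "word_class R u = word_class R v \<longleftrightarrow> word_cong R u v"
proof
  assume "word_class R u = word_class R v"
  moreover have "v \<in> word_class R v"
    by (simp add: word_class_def word_cong.refl)
  ultimately have "v \<in> word_class R u"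
    by simp
  then show "word_cong R u v"
    by (simp add: word_class_def)
next
  assume uv: "word_cong R u v"
  have "word_cong R u w \<longleftrightarrow> word_cong R v w" for w
    using word_cong.trans[OF uv, of w] word_cong.trans[OF word_cong.sym[OF uv], of w] by blast
  then show "word_class R u = word_class R v"
    by (simp add: word_class_def)
qed

lemma presented_group_mult:
  "word_class R u \<otimes>\<^bsub>presented_group R\<^esub> word_class R v = word_class R (u @ v)"
proof -
  have eq: "word_class R (u' @ v') = word_class R (u @ v)"
    if "u' \<in> word_class R u" "v' \<in> word_class R v" for u' v'
    using that unfolding word_class_eq_iff
    by (simp add: word_class_def word_cong.append word_cong.sym)
  have ne: "u \<in> word_class R u" for u
    by (simp add: word_class_def word_cong.refl)
  have "(\<Union>u'\<in>word_class R u. \<Union>v'\<in>word_class R v. word_class R (u' @ v')) =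
      (\<Union>u'\<in>word_class R u. \<Union>v'\<in>word_class R v. word_class R (u @ v))"
    using eq by (simp cong: SUP_cong)
  also have "\<dots> = word_class R (u @ v)"
    using ne by blast
  finally show ?thesis
    by (simp add: presented_group_def)
qed

lemma word_cong_left_inverse:
  "word_cong R (rev (map (\<lambda>(x, b). (x, \<not> b)) u) @ u) []"
proof (induction u)
  case Nil
  show ?case by (simp add: word_cong.refl)
next
  case (Cons l u)
  obtain x b where l: "l = (x, b)" by (cases l)
  let ?w = "rev (map (\<lambda>(x, b). (x, \<not> b)) u)"
  have "word_cong R [(x, \<not> b), (x, b)] []"
    using word_cong.cancel[of R x "\<not> b"] by simp
  then have "word_cong R (?w @ ([(x, \<not> b), (x, b)] @ u)) (?w @ ([] @ u))"
    by (intro word_cong.append word_cong.refl)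
  then show ?case
    using word_cong.trans[OF _ Cons.IH] by (simp add: l)
qed

lemma group_presented_group: "group (presented_group R)"
proof (rule groupI)
  have car: "carrier (presented_group R) = range (word_class R)"
    and one: "\<one>\<^bsub>presented_group R\<^esub> = word_class R []"
    by (simp_all add: presented_group_def)
  show "\<one>\<^bsub>presented_group R\<^esub> \<in> carrier (presented_group R)"
    by (simp add: car one)
  show "A \<otimes>\<^bsub>presented_group R\<^esub> B \<in> carrier (presented_group R)"
    if "A \<in> carrier (presented_group R)" "B \<in> carrier (presented_group R)" for A B
    using that by (auto simp: car presented_group_mult)
  show "A \<otimes>\<^bsub>presented_group R\<^esub> B \<otimes>\<^bsub>presented_group R\<^esub> C =
      A \<otimes>\<^bsub>presented_group R\<^esub> (B \<otimes>\<^bsub>presented_group R\<^esub> C)"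
    if "A \<in> carrier (presented_group R)" "B \<in> carrier (presented_group R)"
      "C \<in> carrier (presented_group R)" for A B C
    using that by (auto simp: car presented_group_mult)
  fix A assume "A \<in> carrier (presented_group R)"
  then obtain u where A: "A = word_class R u" by (auto simp: car)
  show "\<one>\<^bsub>presented_group R\<^esub> \<otimes>\<^bsub>presented_group R\<^esub> A = A"
    by (simp add: A one presented_group_mult)
  show "\<exists>B\<in>carrier (presented_group R). B \<otimes>\<^bsub>presented_group R\<^esub> A = \<one>\<^bsub>presented_group R\<^esub>"
    using word_cong_left_inverse[of R u]
    by (auto simp: A one car presented_group_mult word_class_eq_iff)
qed

section \<open>The semidihedral group of order 16\<close>

datatype sd_gen = GenX | GenY

definition sd16_relations :: "(sd_gen gword \<times> sd_gen gword) set" where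
  "sd16_relations =
    {(replicate 8 (GenX, True), []),
     (replicate 2 (GenY, True), []),
     ([(GenY, True), (GenX, True), (GenY, True)], replicate 3 (GenX, True))}"

definition SD16 :: "sd_gen gword set monoid" where
  "SD16 = presented_group sd16_relations"

lemma group_SD16: "group SD16"
  unfolding SD16_def by (rule group_presented_group)

text \<open>The regular action on the normal forms \<open>X^i Y^j\<close>, encoded as \<open>(i, j)\<close>.\<close>

fun sd16_act :: "sd_gen \<times> bool \<Rightarrow> nat \<times> bool \<Rightarrow> nat \<times> bool" where
  "sd16_act (GenX, True) (i, j) = ((i + 1) mod 8, j)"
| "sd16_act (GenX, False) (i, j) = ((i + 7) mod 8, j)"
| "sd16_act (GenY, _) (i, j) = (3 * i mod 8, \<not> j)"

definition sd16_normal :: "nat \<times> bool \<Rightarrow> sd_gen gword" where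
  "sd16_normal = (\<lambda>(i, j). replicate i (GenX, True) @ (if j then [(GenY, True)] else []))"

lemma sd16_act_closed: "fst s < 8 \<Longrightarrow> fst (foldr sd16_act w s) < 8"
proof (induction w)
  case (Cons l w)
  then show ?case
    by (cases "(l, foldr sd16_act w s)" rule: sd16_act.cases) auto
qed simp

lemma sd16_act_cong:
  "word_cong sd16_relations u v \<Longrightarrow> fst s < 8 \<Longrightarrow> foldr sd16_act u s = foldr sd16_act v s"
proof (induction arbitrary: s rule: word_cong.induct)
  case (append u u' v v')
  then show ?case by (simp add: sd16_act_closed)
next
  case (cancel x b)
  obtain i j where s: "s = (i, j)" by (cases s)
  with cancel have "i \<in> {0,1,2,3,4,5,6,7}" by auto
  then show ?case by (cases x; cases b) (auto simp: s)
next
  case (relation u v)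
  obtain i j where s: "s = (i, j)" by (cases s)
  with relation have "i \<in> {0,1,2,3,4,5,6,7}" by auto
  moreover have "replicate 8 l = [l, l, l, l, l, l, l, l]" "replicate 3 l = [l, l, l]"
    "replicate 2 l = [l, l]" for l :: "sd_gen \<times> bool"
    by (simp_all add: numeral_eq_Suc)
  ultimately show ?case
    using relation.hyps unfolding sd16_relations_def by (elim insertE) (simp_all add: s)
qed auto

lemma sd16_act_normal: "i < 8 \<Longrightarrow> foldr sd16_act (sd16_normal (i, j)) (0, False) = (i, j)"
proof -
  have "i < 8 \<Longrightarrow> foldr sd16_act (replicate i (GenX, True)) (0, j) = (i, j)"
    by (induction i) auto
  then show "i < 8 \<Longrightarrow> ?thesis"
    by (cases j) (auto simp: sd16_normal_def)
qed

lemma order_SD16: "order SD16 = 16"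
proof -
  let ?R = "sd16_relations"
  define N where "N = {..<8::nat} \<times> (UNIV :: bool set)"
  note [trans] = word_cong.trans
  have app: "word_cong ?R (a @ u @ b) (a @ v @ b)" if "word_cong ?R u v" for a b u v
    by (intro word_cong.append word_cong.refl that)
  have x8: "word_cong ?R (replicate 8 (GenX, True)) []"
    and y2: "word_cong ?R [(GenY, True), (GenY, True)] []"
    and yxy: "word_cong ?R [(GenY, True), (GenX, True), (GenY, True)] (replicate 3 (GenX, True))"
    by (auto intro!: word_cong.relation simp: sd16_relations_def numeral_2_eq_2)
  have xinv: "word_cong ?R [(GenX, False)] (replicate 7 (GenX, True))"
  proof -
    have "word_cong ?R [(GenX, False)] ([(GenX, False)] @ replicate 8 (GenX, True) @ [])"
      using app[OF word_cong.sym[OF x8], of "[(GenX, False)]" "[]"] by simp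
    also have "[(GenX, False)] @ replicate 8 (GenX, True) @ [] =
        [] @ [(GenX, False), (GenX, \<not> False)] @ replicate 7 (GenX, True)"
      by (simp add: numeral_eq_Suc)
    also have "word_cong ?R \<dots> ([] @ [] @ replicate 7 (GenX, True))"
      by (intro app word_cong.cancel)
    finally show ?thesis by simp
  qed
  have yinv: "word_cong ?R [(GenY, False)] [(GenY, True)]"
  proof -
    have "word_cong ?R [(GenY, False)] ([(GenY, False)] @ [(GenY, True), (GenY, True)] @ [])"
      using app[OF word_cong.sym[OF y2], of "[(GenY, False)]" "[]"] by simp
    also have "\<dots> = [] @ [(GenY, False), (GenY, \<not> False)] @ [(GenY, True)]"
      by simp
    also have "word_cong ?R \<dots> ([] @ [] @ [(GenY, True)])"
      by (intro app word_cong.cancel)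
    finally show ?thesis by simp
  qed
  have yx: "word_cong ?R [(GenY, True), (GenX, True)] (replicate 3 (GenX, True) @ [(GenY, True)])"
  proof -
    have "word_cong ?R [(GenY, True), (GenX, True)]
        ([(GenY, True), (GenX, True)] @ [(GenY, True), (GenY, True)] @ [])"
      using app[OF word_cong.sym[OF y2], of "[(GenY, True), (GenX, True)]" "[]"] by simp
    also have "\<dots> = [] @ [(GenY, True), (GenX, True), (GenY, True)] @ [(GenY, True)]"
      by simp
    also have "word_cong ?R \<dots> ([] @ replicate 3 (GenX, True) @ [(GenY, True)])"
      by (intro app yxy)
    finally show ?thesis by simp
  qed
  have yxi: "word_cong ?R ((GenY, True) # replicate i (GenX, True))
      (replicate (3 * i) (GenX, True) @ [(GenY, True)])" for i
  proof (induction i)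
    case 0
    show ?case by (simp add: word_cong.refl)
  next
    case (Suc i)
    have "(GenY, True) # replicate (Suc i) (GenX, True) =
        [] @ [(GenY, True), (GenX, True)] @ replicate i (GenX, True)" by simp
    also have "word_cong ?R \<dots>
        ([] @ (replicate 3 (GenX, True) @ [(GenY, True)]) @ replicate i (GenX, True))"
      by (intro app yx)
    also have "\<dots> =
        replicate 3 (GenX, True) @ ((GenY, True) # replicate i (GenX, True)) @ []" by simp
    also have "word_cong ?R \<dots>
        (replicate 3 (GenX, True) @ (replicate (3 * i) (GenX, True) @ [(GenY, True)]) @ [])"
      by (intro app Suc.IH)
    also have "\<dots> = replicate (3 * Suc i) (GenX, True) @ [(GenY, True)]"
      by (simp add: replicate_add[symmetric] append_assoc[symmetric] del: append_assoc replicate.simps)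
    finally show ?case .
  qed
  have xmod: "word_cong ?R (replicate i (GenX, True)) (replicate (i mod 8) (GenX, True))" for i
  proof (induction i rule: less_induct)
    case (less i)
    show ?case
    proof (cases "i < 8")
      case True
      then show ?thesis by (simp add: word_cong.refl)
    next
      case False
      then have "replicate i (GenX, True) =
          [] @ replicate 8 (GenX, True) @ replicate (i - 8) (GenX, True)"
        by (simp add: replicate_add[symmetric])
      also have "word_cong ?R \<dots> ([] @ [] @ replicate (i - 8) (GenX, True))"
        by (intro app x8)
      also have "\<dots> = replicate (i - 8) (GenX, True)" by simp
      also have "word_cong ?R \<dots> (replicate ((i - 8) mod 8) (GenX, True))"
        using False by (intro less.IH) simp
      also have "(i - 8) mod 8 = i mod 8"
        using False by (simp add: le_mod_geq)
      finally show ?thesis .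
    qed
  qed
  have step: "word_cong ?R (l # sd16_normal s) (sd16_normal (sd16_act l s))" for l s
  proof -
    obtain i j where s: "s = (i, j)" by (cases s)
    let ?t = "if j then [(GenY, True)] else []"
    have norm: "word_cong ?R (replicate k (GenX, True) @ ?t) (sd16_normal (k mod 8, j))" for k
      using app[OF xmod, of "[]" k ?t] by (simp add: sd16_normal_def)
    have stepY: "word_cong ?R ((GenY, True) # sd16_normal s) (sd16_normal (3 * i mod 8, \<not> j))"
    proof -
      have "(GenY, True) # sd16_normal s = [] @ ((GenY, True) # replicate i (GenX, True)) @ ?t"
        by (simp add: s sd16_normal_def)
      also have "word_cong ?R \<dots> ([] @ (replicate (3 * i) (GenX, True) @ [(GenY, True)]) @ ?t)"
        by (intro app yxi)
      also have "\<dots> = [] @ replicate (3 * i) (GenX, True) @ ([(GenY, True)] @ ?t)"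
        by simp
      also have "word_cong ?R \<dots> ([] @ replicate (3 * i mod 8) (GenX, True) @ ([(GenY, True)] @ ?t))"
        by (intro app xmod)
      also have "word_cong ?R \<dots> (sd16_normal (3 * i mod 8, \<not> j))"
        using app[OF y2, of "replicate (3 * i mod 8) (GenX, True)" "[]"]
        by (cases j) (simp_all add: sd16_normal_def word_cong.refl)
      finally show ?thesis .
    qed
    consider "l = (GenX, True)" | "l = (GenX, False)" | "l = (GenY, True)" | "l = (GenY, False)"
      by (cases l; cases "fst l"; cases "snd l") auto
    then show ?thesis
    proof cases
      case 1
      then show ?thesis using norm[of "Suc i"] by (simp add: s sd16_normal_def)
    next
      case 2
      have "word_cong ?R ([] @ [(GenX, False)] @ sd16_normal s)
          ([] @ replicate 7 (GenX, True) @ sd16_normal s)"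
        by (intro app xinv)
      also have "\<dots> = replicate (i + 7) (GenX, True) @ ?t"
        by (simp add: s sd16_normal_def add.commute[of i] replicate_add)
      also have "word_cong ?R \<dots> (sd16_normal ((i + 7) mod 8, j))"
        by (rule norm)
      finally show ?thesis by (simp add: 2 s)
    next
      case 3
      then show ?thesis using stepY by (simp add: s)
    next
      case 4
      have "word_cong ?R ([] @ [(GenY, False)] @ sd16_normal s) ([] @ [(GenY, True)] @ sd16_normal s)"
        by (intro app yinv)
      also have "\<dots> = (GenY, True) # sd16_normal s" by simp
      also note stepY
      finally show ?thesis by (simp add: 4 s)
    qed
  qed
  have nf: "word_cong ?R w (sd16_normal (foldr sd16_act w (0, False)))" for w
  proof (induction w)
    case Nil
    show ?case by (simp add: sd16_normal_def word_cong.refl)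
  next
    case (Cons l w)
    have "word_cong ?R ([l] @ w @ []) ([l] @ sd16_normal (foldr sd16_act w (0, False)) @ [])"
      by (intro app Cons.IH)
    then show ?case using step word_cong.trans by fastforce
  qed
  have "carrier SD16 = (word_class ?R \<circ> sd16_normal) ` N"
  proof
    show "carrier SD16 \<subseteq> (word_class ?R \<circ> sd16_normal) ` N"
    proof
      fix A assume "A \<in> carrier SD16"
      then obtain w where "A = word_class ?R w"
        by (auto simp: SD16_def presented_group_def)
      then have "A = (word_class ?R \<circ> sd16_normal) (foldr sd16_act w (0, False))"
        using nf by (simp add: word_class_eq_iff)
      moreover have "foldr sd16_act w (0, False) \<in> N"
        using sd16_act_closed[of "(0, False)" w] by (simp add: N_def mem_Times_iff)
      ultimately show "A \<in> (word_class ?R \<circ> sd16_normal) ` N" by blast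
    qed
  qed (auto simp: SD16_def presented_group_def)
  moreover have "inj_on (word_class ?R \<circ> sd16_normal) N"
  proof (rule inj_onI)
    fix s t assume st: "s \<in> N" "t \<in> N"
      and "(word_class ?R \<circ> sd16_normal) s = (word_class ?R \<circ> sd16_normal) t"
    then have "word_cong ?R (sd16_normal s) (sd16_normal t)"
      by (simp add: word_class_eq_iff)
    from sd16_act_cong[OF this, of "(0, False)"] show "s = t"
      using st by (cases s; cases t) (simp add: N_def sd16_act_normal)
  qed
  ultimately have "order SD16 = card N"
    by (simp only: order_def card_image)
  then show ?thesis
    by (simp add: N_def card_cartesian_product)
qed

end

theory Submission
  imports Defs "HOL-Library.Discrete_Functions" "Jordan_Normal_Form.Determinant"
begin

text \<open>Write an element of the group ring as \<open>f(X) + g(X) Y\<close>. In a suitable ordering of the group its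
  matrix consists of four commuting 8 by 8 circulants, and the determinant becomes that of the
  circulant of \<open>f(x) f(x^3) - g(x) g(x^3)\<close>, which factors as
  \<open>(f(1)^2 - g(1)^2) (f(-1)^2 - g(-1)^2) (|f(i)|^2 - |g(i)|^2)^2 (A^2 + 2 B^2)^2\<close>.

  Parities of the factors give divisibility by \<open>2^10\<close> in the even case. In the odd case only
  the first two factors matter modulo 8; the value is 1 or 5, and 5 forces \<open>B\<close> to be odd, so
  \<open>A^2 + 2 B^2\<close> is 3 modulo 8 and has a prime divisor congruent to 3 modulo 8, since all
  prime divisors of a primitively represented odd number are 1 or 3 modulo 8 (Thue).
  Conversely, primes congruent to 3 modulo 8 have the form \<open>A^2 + 2 B^2\<close>, and the elements
  \<open>1 + h(X) (1 + Y)\<close> realise all the odd values.\<close>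

section \<open>The quadratic form \<open>x^2 + 2 y^2\<close>\<close>

text \<open>Pigeonhole: with \<open>k\<close> the integer square root of \<open>p\<close> there are
  \<open>(k + 1)^2 > p\<close> pairs with entries in \<open>{0..k}\<close>, so two distinct pairs
  give the same residue of \<open>x - a * y\<close>; their difference is the solution.\<close>

lemma thue:
  fixes p a :: int
  assumes p: "prime p"
  shows "\<exists>x y. (x \<noteq> 0 \<or> y \<noteq> 0) \<and> x\<^sup>2 < p \<and> y\<^sup>2 < p \<and> p dvd x - a * y"
proof -
  define k where "k = floor_sqrt (nat p)"
  have p1: "p > 1" using p by (simp add: prime_gt_1_int)
  have "k\<^sup>2 \<le> nat p" by (simp add: k_def)
  then have "int (k\<^sup>2) \<le> int (nat p)" by (simp only: of_nat_le_iff)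
  then have kp': "(int k)\<^sup>2 \<le> p" using p1 by simp
  \<comment> \<open>A prime is not a square; this makes the bounds on \<open>x\<close> and
    \<open>y\<close> strict.\<close>
  have "(int k)\<^sup>2 \<noteq> p" using p by (auto simp: prime_power_iff)
  with kp' have kp: "(int k)\<^sup>2 < p" by simp
  have "nat p < (Suc k)\<^sup>2" unfolding k_def by (rule Suc_floor_sqrt_power2_gt)
  moreover have "card ({0..int k} \<times> {0..int k}) = (Suc k)\<^sup>2"
    by (simp add: card_cartesian_product power2_eq_square nat_add_distrib)
  moreover have "card {0..<p} = nat p" by simp
  moreover have "(\<lambda>(x, y). (x - a * y) mod p) ` ({0..int k} \<times> {0..int k}) \<subseteq> {0..<p}"
    using p1 by auto
  ultimately have "\<not> inj_on (\<lambda>(x, y). (x - a * y) mod p) ({0..int k} \<times> {0..int k})"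
    by (metis card_inj_on_le finite_atLeastLessThan_int not_less)
  then obtain x y x' y'
    where b: "x \<in> {0..int k}" "y \<in> {0..int k}" "x' \<in> {0..int k}" "y' \<in> {0..int k}"
    and ne: "(x, y) \<noteq> (x', y')" and eq: "(x - a * y) mod p = (x' - a * y') mod p"
    unfolding inj_on_def by auto
  have "p dvd (x - x') - a * (y - y')"
    using eq by (simp add: mod_eq_dvd_iff algebra_simps)
  moreover have "u\<^sup>2 < p" if "\<bar>u\<bar> \<le> int k" for u
    using that kp power_mono[of "\<bar>u\<bar>" "int k" 2] by simp
  then have "(x - x')\<^sup>2 < p" "(y - y')\<^sup>2 < p" using b by auto
  ultimately show ?thesis using ne by (intro exI[of _ "x - x'"] exI[of _ "y - y'"]) auto
qed

lemma odd_square_mod_8: "odd (x::int) \<Longrightarrow> x\<^sup>2 mod 8 = 1"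
proof -
  assume "odd x"
  then obtain k where "x = 2 * k + 1" by (elim oddE)
  moreover have "even (k * (k + 1))" by simp
  then obtain l where "k * (k + 1) = 2 * l" by (elim evenE)
  ultimately have "x\<^sup>2 = 8 * l + 1" by (simp add: power2_eq_square algebra_simps)
  then show ?thesis by simp
qed

text \<open>Thue's lemma for \<open>a\<close> gives a positive value of the form that is divisible
  by \<open>p\<close> and below \<open>3 * p\<close>, so it is \<open>p\<close> or
  \<open>2 * p\<close>. In the second case \<open>x\<close> is even, and halving the equation
  represents \<open>p\<close> with the two squares exchanged.\<close>

lemma prime_dvd_square_plus_2_imp_form:
  fixes p a :: int
  assumes p: "prime p" and a: "p dvd a\<^sup>2 + 2"
  shows "\<exists>x y. p = x\<^sup>2 + 2 * y\<^sup>2"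
proof -
  obtain x y where xy: "x \<noteq> 0 \<or> y \<noteq> 0" "x\<^sup>2 < p" "y\<^sup>2 < p" and d: "p dvd x - a * y"
    using thue[OF p] by blast
  have "x\<^sup>2 + 2 * y\<^sup>2 = (x - a * y) * (x + a * y) + (a\<^sup>2 + 2) * y\<^sup>2"
    by (simp add: power2_eq_square algebra_simps)
  then have "p dvd x\<^sup>2 + 2 * y\<^sup>2" using a d by simp
  then obtain k where k: "x\<^sup>2 + 2 * y\<^sup>2 = p * k" by (elim dvdE)
  have p0: "p > 0" using p by (simp add: prime_gt_0_int)
  have "0 < x\<^sup>2 + 2 * y\<^sup>2" using xy(1) by (auto intro: add_pos_nonneg add_nonneg_pos)
  then have "0 < k" using k p0 by (simp add: zero_less_mult_iff)
  moreover have "p * k < p * 3" using k xy by simp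
  then have "k < 3" using p0 by simp
  ultimately have "k = 1 \<or> k = 2" by auto
  then show ?thesis
  proof
    assume "k = 1"
    then show ?thesis using k by auto
  next
    assume k2: "k = 2"
    then have "x\<^sup>2 = 2 * (p - y\<^sup>2)" using k by simp
    then have "even (x\<^sup>2)" by simp
    then have "even x" by simp
    then obtain z where "x = 2 * z" by (elim evenE)
    then have "p = y\<^sup>2 + 2 * z\<^sup>2" using k k2 by (simp add: power2_eq_square)
    then show ?thesis by blast
  qed
qed

lemma odd_form_mod_8:
  fixes x y :: int
  assumes "odd (x\<^sup>2 + 2 * y\<^sup>2)"
  shows "(x\<^sup>2 + 2 * y\<^sup>2) mod 8 = (if odd y then 3 else 1)"
proof -
  have x: "x\<^sup>2 mod 8 = 1" using assms odd_square_mod_8 by simp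
  show ?thesis
  proof (cases "odd y")
    case True
    then show ?thesis using x odd_square_mod_8[OF True] by presburger
  next
    case False
    then obtain z where "y = 2 * z" by (auto elim: evenE)
    then have "x\<^sup>2 + 2 * y\<^sup>2 = x\<^sup>2 + 8 * z\<^sup>2" by (simp add: power2_eq_square)
    then show ?thesis using False x by simp
  qed
qed

section \<open>The quadratic character of 2 and -2 modulo primes congruent to 3 modulo 8\<close>

lemma square_neq_two_times_square:
  fixes x y :: int
  assumes "y \<noteq> 0"
  shows "x\<^sup>2 \<noteq> 2 * y\<^sup>2"
proof
  assume eq: "x\<^sup>2 = 2 * y\<^sup>2"
  then have x: "x \<noteq> 0" using assms by auto
  \<comment> \<open>The exponent of 2 is even in a square but odd in twice a nonzero square.\<close>
  have "2 * multiplicity 2 x = multiplicity 2 (x\<^sup>2)"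
    using x by (simp add: prime_elem_multiplicity_power_distrib)
  also have "\<dots> = 1 + 2 * multiplicity 2 y"
    using assms unfolding eq
    by (simp add: prime_elem_multiplicity_mult_distrib prime_elem_multiplicity_power_distrib)
  finally show False by presburger
qed

text \<open>By Thue's lemma a square root of 2 modulo \<open>p\<close> yields a nonzero multiple of
  \<open>p\<close> of the form \<open>x^2 - 2 * y^2\<close> strictly between \<open>-2 * p\<close>
  and \<open>p\<close>, hence \<open>p = 2 * y^2 - x^2\<close>. With \<open>x\<close> odd this is 1
  or 7 modulo 8.\<close>

lemma two_not_QuadRes:
  fixes p :: int
  assumes p: "prime p" and p8: "p mod 8 = 3"
  shows "\<not> QuadRes p 2"
proof
  assume "QuadRes p 2"
  then obtain a where a: "p dvd a\<^sup>2 - 2"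
    unfolding QuadRes_def cong_iff_dvd_diff by blast
  obtain x y where xy: "x \<noteq> 0 \<or> y \<noteq> 0" "x\<^sup>2 < p" "y\<^sup>2 < p" and d: "p dvd x - a * y"
    using thue[OF p] by blast
  have "x\<^sup>2 - 2 * y\<^sup>2 = (x - a * y) * (x + a * y) + (a\<^sup>2 - 2) * y\<^sup>2"
    by (simp add: power2_eq_square algebra_simps)
  then have "p dvd x\<^sup>2 - 2 * y\<^sup>2" using a d by simp
  then obtain k where k: "x\<^sup>2 - 2 * y\<^sup>2 = p * k" by (elim dvdE)
  have p0: "p > 0" using p by (simp add: prime_gt_0_int)
  have "x\<^sup>2 - 2 * y\<^sup>2 \<noteq> 0"
    using square_neq_two_times_square[of y x] xy(1) by (cases "y = 0") auto
  then have "k \<noteq> 0" using k by auto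
  moreover have "p * k < p * 1" "p * (-2) < p * k"
    using k xy zero_le_power2[of x] zero_le_power2[of y] by linarith+
  then have "k < 1" "-2 < k" using p0 by (simp_all only: mult_less_cancel_left_pos)
  ultimately have "k = -1" by simp
  then have py: "p = 2 * y\<^sup>2 - x\<^sup>2" using k by simp
  have "odd p" using p8 by presburger
  then have "odd x" using py by auto
  then have x8: "x\<^sup>2 mod 8 = 1" by (rule odd_square_mod_8)
  show False
  proof (cases "odd y")
    case True
    then show False using odd_square_mod_8[OF True] x8 py p8 by presburger
  next
    case False
    then obtain z where "y = 2 * z" by (auto elim: evenE)
    then have "p = 8 * z\<^sup>2 - x\<^sup>2" using py by (simp add: power2_eq_square)
    then show False using x8 p8 by presburger
  qed
qed

text \<open>Since 2 is a non-residue, Euler's criterion gives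
  \<open>2 ^ ((q - 1) div 2) = -1\<close> modulo \<open>q\<close>. The exponent is odd, so the same
  power of -2 is 1 and -2 is a residue.\<close>

lemma prime_3_mod_8_form:
  fixes p :: int
  assumes p: "prime p" and p8: "p mod 8 = 3"
  shows "\<exists>x y. p = x\<^sup>2 + 2 * y\<^sup>2"
proof -
  define q where "q = nat p"
  have pq: "p = int q" using p by (simp add: q_def prime_ge_0_int)
  have q: "prime q" using p by (simp add: pq)
  have "int (q mod 8) = int 3" using p8 by (simp add: pq zmod_int)
  then have "q mod 8 = 3" by (simp only: of_nat_eq_iff)
  then have t: "q = 8 * (q div 8) + 3" using mult_div_mod_eq[of 8 q] by simp
  then have q2: "2 < q" by simp
  let ?k = "(q - 1) div 2"
  have "odd ?k" by (subst t) simp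
  have "\<not> [2 = 0] (mod int q)"
    using q2 by (simp add: cong_0_iff zdvd_not_zless)
  then have "Legendre 2 q = -1"
    using two_not_QuadRes[OF p p8] by (simp add: Legendre_def pq)
  then have "[-1 = 2 ^ ?k] (mod int q)"
    using euler_criterion[OF q q2, of 2] by simp
  then have "[- (-1) = - (2 ^ ?k)] (mod int q)"
    by (simp only: cong_minus_minus_iff)
  moreover have "- (2 ^ ?k) = (-2 :: int) ^ ?k" using \<open>odd ?k\<close> by simp
  ultimately have "[1 = Legendre (-2) q] (mod int q)"
    using euler_criterion[OF q q2, of "-2"] by (metis cong_trans cong_sym minus_minus)
  \<comment> \<open>The other two values would make \<open>q\<close> divide 2 or 1.\<close>
  then have "Legendre (-2) q \<noteq> -1" "Legendre (-2) q \<noteq> 0"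
    using q2 by (auto simp: cong_iff_dvd_diff zdvd_not_zless)
  then have "QuadRes p (-2)" by (auto simp: Legendre_def pq split: if_splits)
  then obtain a where "p dvd a\<^sup>2 + 2"
    unfolding QuadRes_def cong_iff_dvd_diff by auto
  then show ?thesis by (rule prime_dvd_square_plus_2_imp_form[OF p])
qed

section \<open>Prime divisors of numbers represented by the form\<close>

lemma cong_1_if_prime_divisors_cong_1:
  fixes n m :: int
  assumes "n > 0" "\<And>p. prime p \<Longrightarrow> p dvd n \<Longrightarrow> [p = 1] (mod m)"
  shows "[n = 1] (mod m)"
  using assms
proof (induction n rule: prime_divisors_induct)
  case (unit n)
  \<comment> \<open>Positivity leaves 1 as the only possible unit.\<close>
  then show ?case by simp
next
  case (factor p n)
  have "p > 0" using factor.hyps by (simp add: prime_gt_0_int)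
  then have "n > 0" using factor.prems(1) by (simp add: zero_less_mult_iff)
  then have "[n = 1] (mod m)" using factor by simp
  moreover have "[p = 1] (mod m)" using factor by simp
  ultimately show ?case using cong_mult[of p 1 m n 1] by simp
qed simp

lemma odd_if_mod_8_eq_3: "(n::int) mod 8 = 3 \<Longrightarrow> odd n"
  by presburger

text \<open>Dividing out the odd square of the gcd keeps the residue 3 and leaves a primitive
  representation. Each prime divisor of the quotient is then itself of the form, hence 1 or 3 modulo
  8; if all were 1, so would be the quotient.\<close>

lemma form_3_mod_8_prime_divisor:
  fixes x y :: int
  assumes "(x\<^sup>2 + 2 * y\<^sup>2) mod 8 = 3"
  shows "\<exists>p. prime p \<and> p mod 8 = 3 \<and> p dvd x\<^sup>2 + 2 * y\<^sup>2"
proof (rule ccontr)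
  assume no: "\<not> ?thesis"
  define d where "d = gcd x y"
  have "odd (x\<^sup>2 + 2 * y\<^sup>2)" using assms by (rule odd_if_mod_8_eq_3)
  then have "odd x" by simp
  then have d0: "d \<noteq> 0" and "odd d" by (auto simp: d_def)
  obtain u v where uv: "x = u * d" "y = v * d" "coprime u v"
    using gcd_coprime_exists[of x y] d0 unfolding d_def by blast
  let ?n = "u\<^sup>2 + 2 * v\<^sup>2"
  have n: "x\<^sup>2 + 2 * y\<^sup>2 = d\<^sup>2 * ?n" by (simp add: uv power2_eq_square algebra_simps)
  then have "?n mod 8 = 3"
    using assms odd_square_mod_8[OF \<open>odd d\<close>] by (metis mod_mult_left_eq mult_1)
  moreover have "[?n = 1] (mod 8)"
  proof (rule cong_1_if_prime_divisors_cong_1)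
    have "?n \<noteq> 0" using \<open>?n mod 8 = 3\<close> by (metis mod_0 zero_neq_numeral)
    moreover have "?n \<ge> 0" by simp
    ultimately show "?n > 0" by linarith
    fix p :: int assume p: "prime p" and pn: "p dvd ?n"
    have "odd ?n" using \<open>?n mod 8 = 3\<close> by (rule odd_if_mod_8_eq_3)
    then have "odd p" using pn by (auto dest: dvd_trans)
    have "\<not> p dvd v"
    proof
      assume pv: "p dvd v"
      then have "p dvd u\<^sup>2" using pn by (simp add: dvd_add_left_iff power2_eq_square)
      then have "p dvd u" using p by (simp add: prime_dvd_power_iff)
      then show False using pv uv(3) p by (meson not_prime_unit coprime_common_divisor)
    qed
    then have "coprime v p" using p by (simp add: prime_imp_coprime coprime_commute)
    then obtain w where w: "[v * w = 1] (mod p)" using cong_solve_coprime_int by blast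
    \<comment> \<open>As \<open>w\<close> inverts \<open>v\<close> modulo \<open>p\<close>, the
      class of \<open>u * w\<close> is \<open>u / v\<close>, a square root of -2.\<close>
    have "(u * w)\<^sup>2 + 2 = ?n * w\<^sup>2 + (1 - v * w) * (2 * (1 + v * w))"
      by (simp add: power2_eq_square algebra_simps)
    moreover have "p dvd 1 - v * w" using w by (simp add: cong_iff_dvd_diff dvd_diff_commute)
    ultimately have "p dvd (u * w)\<^sup>2 + 2" using pn by (simp only: dvd_add dvd_mult2)
    then obtain s t where "p = s\<^sup>2 + 2 * t\<^sup>2" using prime_dvd_square_plus_2_imp_form[OF p] by blast
    then have "p mod 8 = 1 \<or> p mod 8 = 3" using odd_form_mod_8[of s t] \<open>odd p\<close> by presburger
    moreover have "p mod 8 \<noteq> 3" using no p pn unfolding n by (meson dvd_mult)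
    ultimately show "[p = 1] (mod 8)" by (simp add: cong_def)
  qed
  ultimately show False by (simp add: cong_def)
qed

section \<open>Determinants of circulant matrices\<close>

text \<open>Relabelling along \<open>e\<close> conjugates permutations and so preserves signs; the
  two Leibniz sums agree term by term.\<close>

lemma det_on_image_eq_det:
  fixes A :: "'i \<Rightarrow> 'i \<Rightarrow> 'r::comm_ring_1"
  assumes inj: "inj_on e {0..<n}"
  shows "det_on (e ` {0..<n}) A = det (mat n n (\<lambda>(i, j). A (e i) (e j)))"
proof -
  let ?N = "{0..<n}"
  let ?m = "map_permutation ?N e"
  have bij: "bij_betw e ?N (e ` ?N)"
    using inj by (simp add: bij_betw_def)
  \<comment> \<open>This is the shape in which \<open>bij_betw_permutations\<close> states its
    bijection.\<close>
  have "?m = (\<lambda>p x. if x \<in> e ` ?N then e (p (inv_into ?N e x)) else x)"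
    by (auto simp: fun_eq_iff map_permutation_def restrict_id_def)
  then have bijm: "bij_betw ?m {p. p permutes ?N} {p. p permutes e ` ?N}"
    using bij_betw_permutations[OF bij] by simp
  have "det_on (e ` ?N) A =
      (\<Sum>p | p permutes ?N. of_int (sign (?m p)) * (\<Prod>i\<in>e ` ?N. A i (?m p i)))"
    unfolding det_on_def by (rule sum.reindex_bij_betw[OF bijm, symmetric])
  also have "\<dots> = (\<Sum>p | p permutes ?N. of_int (sign p) *
      (\<Prod>i\<in>?N. mat n n (\<lambda>(i, j). A (e i) (e j)) $$ (i, p i)))"
  proof (rule sum.cong[OF HOL.refl])
    fix p assume "p \<in> {p. p permutes ?N}"
    then have p: "p permutes ?N" by simp
    have "(\<Prod>i\<in>e ` ?N. A i (?m p i)) = (\<Prod>i\<in>?N. A (e i) (?m p (e i)))"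
      using inj by (simp add: prod.reindex)
    also have "\<dots> = (\<Prod>i\<in>?N. mat n n (\<lambda>(i, j). A (e i) (e j)) $$ (i, p i))"
    proof (rule prod.cong[OF HOL.refl])
      fix i assume i: "i \<in> ?N"
      then have "p i < n" using permutes_in_image[OF p, of i] by simp
      then show "A (e i) (?m p (e i)) = mat n n (\<lambda>(i, j). A (e i) (e j)) $$ (i, p i)"
        using i by (simp add: map_permutation_apply[OF inj])
    qed
    finally show "of_int (sign (?m p)) * (\<Prod>i\<in>e ` ?N. A i (?m p i)) =
        of_int (sign p) * (\<Prod>i\<in>?N. mat n n (\<lambda>(i, j). A (e i) (e j)) $$ (i, p i))"
      using sign_map_permutation[OF inj p] by simp
  qed
  also have "\<dots> = det (mat n n (\<lambda>(i, j). A (e i) (e j)))"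
    by (simp add: det_def)
  finally show ?thesis .
qed

text \<open>Adding the second block column to the first and then subtracting the first block row
  from the second makes the matrix block triangular; both operations are unimodular.\<close>

lemma det_four_block_mat_symmetric:
  fixes U V :: "'a::idom mat"
  assumes U: "U \<in> carrier_mat n n" and V: "V \<in> carrier_mat n n"
  shows "det (four_block_mat U V V U) = det (U + V) * det (U - V)"
proof -
  let ?I = "1\<^sub>m n :: 'a mat" and ?O = "0\<^sub>m n n :: 'a mat"
  let ?M = "four_block_mat U V V U"
  let ?L = "four_block_mat ?I ?O (- ?I) ?I" and ?R = "four_block_mat ?I ?O ?I ?I"
  have M: "?M \<in> carrier_mat (n + n) (n + n)" and L: "?L \<in> carrier_mat (n + n) (n + n)"
    and R: "?R \<in> carrier_mat (n + n) (n + n)"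
    using U V by auto
  have "?M * ?R = four_block_mat (U + V) V (V + U) U"
    by (subst mult_four_block_mat[OF U V V U, of _ n _ n]) (use U V in auto)
  then have "?L * (?M * ?R) = four_block_mat (U + V) V ?O (U - V)"
    by (simp, subst mult_four_block_mat[of _ n n _ n _ n _ _ n _ n])
      (use U V in \<open>auto intro!: arg_cong2[where f = "\<lambda>A. four_block_mat _ _ A"] eq_matI\<close>)
  then have "det (four_block_mat (U + V) V ?O (U - V)) = det ?L * (det ?M * det ?R)"
    using det_mult[OF L mult_carrier_mat[OF M R]] det_mult[OF M R] by simp
  moreover have "det ?L = 1" "det ?R = 1"
    by (subst det_four_block_mat_upper_right_zero[where n = n and m = n]; simp)+
  moreover have "det (four_block_mat (U + V) V ?O (U - V)) = det (U + V) * det (U - V)"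
    by (rule det_four_block_mat_lower_left_zero[where n = n and m = n]) (use U V in auto)
  ultimately show ?thesis by simp
qed

text \<open>The matrix of multiplication by the sum of \<open>c k * x^k\<close> modulo
  \<open>x^n - 1\<close>. Integer indices avoid truncated subtraction.\<close>

definition circulant :: "nat \<Rightarrow> (int \<Rightarrow> 'a) \<Rightarrow> 'a mat" where
  "circulant n c = mat n n (\<lambda>(i, j). c ((int i - int j) mod int n))"

text \<open>Coefficients of the product of two polynomials modulo \<open>x^n - 1\<close>.\<close>

definition cyclic_conv :: "nat \<Rightarrow> (int \<Rightarrow> 'a::comm_ring_1) \<Rightarrow> (int \<Rightarrow> 'a) \<Rightarrow> int \<Rightarrow> 'a" where
  "cyclic_conv n c d k = (\<Sum>l = 0..<int n. c l * d ((k - l) mod int n))"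

lemma circulant_carrier [simp]: "circulant n c \<in> carrier_mat n n"
  by (simp add: circulant_def)

lemma bij_betw_diff_mod:
  assumes "n > 0"
  shows "bij_betw (\<lambda>l. (a - l) mod int n) {0..<int n} {0..<int n}"
  by (rule bij_betw_byWitness[where f' = "\<lambda>l. (a - l) mod int n"])
    (use assms in \<open>auto simp: mod_diff_right_eq\<close>)

lemma cyclic_conv_commute: "cyclic_conv n c d k = cyclic_conv n d c k"
proof (cases "n = 0")
  case False
  have "cyclic_conv n c d k =
      (\<Sum>l = 0..<int n. c ((k - l) mod int n) * d ((k - (k - l) mod int n) mod int n))"
    unfolding cyclic_conv_def using False
    by (subst sum.reindex_bij_betw[OF bij_betw_diff_mod[of n k], symmetric]) auto
  also have "\<dots> = cyclic_conv n d c k"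
    unfolding cyclic_conv_def
    by (rule sum.cong) (auto simp: mod_diff_right_eq mult.commute)
  finally show ?thesis .
qed (simp add: cyclic_conv_def)

lemma circulant_mult: "circulant n c * circulant n d = circulant n (cyclic_conv n c d)"
proof (rule eq_matI)
  fix i j assume ij: "i < dim_row (circulant n (cyclic_conv n c d))"
    "j < dim_col (circulant n (cyclic_conv n c d))"
  then have n: "n > 0" and i: "i < n" and j: "j < n" by (auto simp: circulant_def)
  have "(circulant n c * circulant n d) $$ (i, j) =
      (\<Sum>l = 0..<n. c ((int i - int l) mod int n) * d ((int l - int j) mod int n))"
    using i j by (simp add: circulant_def scalar_prod_def)
  also have "\<dots> = (\<Sum>l = 0..<int n. c ((int i - l) mod int n) * d ((l - int j) mod int n))"
    by (rule sum.reindex_bij_witness[where i = nat and j = int]) auto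
  also have "\<dots> = (\<Sum>l = 0..<int n. c l * d (((int i - int j) mod int n - l) mod int n))"
  proof -
    have eq: "((int i - int j) mod int n - (int i - l) mod int n) mod int n = (l - int j) mod int n" for l
    proof -
      have "((int i - int j) mod int n - (int i - l) mod int n) mod int n =
          ((int i - int j) - (int i - l)) mod int n"
        by (rule mod_diff_eq)
      then show ?thesis by simp
    qed
    \<comment> \<open>Substituting \<open>i - l\<close> for \<open>l\<close> in the right-hand sum
      turns the convolution into the matrix product.\<close>
    show ?thesis
      by (subst (2) sum.reindex_bij_betw[OF bij_betw_diff_mod[OF n, of "int i"], symmetric])
        (simp only: eq)
  qed
  also have "\<dots> = circulant n (cyclic_conv n c d) $$ (i, j)"
    using i j by (simp add: circulant_def cyclic_conv_def)
  finally show "(circulant n c * circulant n d) $$ (i, j) =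
    circulant n (cyclic_conv n c d) $$ (i, j)" .
qed (auto simp: circulant_def)

text \<open>Commutation is what \<open>det_four_block_mat\<close> asks of the blocks of the group
  matrix.\<close>

lemma circulant_mult_commute:
  "circulant n c * circulant n (d :: int \<Rightarrow> 'a::comm_ring_1) = circulant n d * circulant n c"
  unfolding circulant_mult by (simp add: circulant_def cyclic_conv_commute[of n c d])

lemma circulant_diff: "circulant n c - circulant n d = circulant n (\<lambda>k. c k - (d k :: 'a :: ring))"
  by (rule eq_matI) (auto simp: circulant_def)

section \<open>Explicit determinants of small size and of the symmetric circulant of order 8\<close>

lemma det_2:
  fixes A :: "'a::comm_ring_1 mat"
  assumes A: "A \<in> carrier_mat 2 2"
  shows "det A = A $$ (0,0) * A $$ (1,1) - A $$ (0,1) * A $$ (1,0)"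
  by (subst laplace_expansion_row[OF A, of 0])
    (use A in \<open>simp_all add: cofactor_def det_single mat_delete_def lessThan_nat_numeral numeral_2_eq_2\<close>)

lemma det_3:
  fixes A :: "'a::comm_ring_1 mat"
  assumes A: "A \<in> carrier_mat 3 3"
  shows "det A =
    A $$ (0,0) * (A $$ (1,1) * A $$ (2,2) - A $$ (1,2) * A $$ (2,1)) -
    A $$ (0,1) * (A $$ (1,0) * A $$ (2,2) - A $$ (1,2) * A $$ (2,0)) +
    A $$ (0,2) * (A $$ (1,0) * A $$ (2,1) - A $$ (1,1) * A $$ (2,0))"
  by (subst laplace_expansion_row[OF A, of 0])
    (use A in \<open>simp_all add: cofactor_def det_2 mat_delete_def numeral_3_eq_3 numeral_2_eq_2 algebra_simps\<close>)

lemma det_4: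
  fixes A :: "'a::comm_ring_1 mat"
  assumes A: "A \<in> carrier_mat 4 4"
  shows "det A =
    A $$ (0,0) * det (mat_delete A 0 0) - A $$ (0,1) * det (mat_delete A 0 1) +
    A $$ (0,2) * det (mat_delete A 0 2) - A $$ (0,3) * det (mat_delete A 0 3)"
  by (subst laplace_expansion_row[OF A, of 0])
    (simp_all add: cofactor_def numeral_eq_Suc)

text \<open>The hypotheses say that \<open>c\<close> is invariant under tripling indices modulo 8.
  \<open>U + V\<close> is the reduction modulo \<open>x^4 - 1\<close>, with factors from 1, -1, i
  and -i; \<open>U - V\<close> is the reduction modulo \<open>x^4 + 1\<close>, where the primitive
  eighth roots of unity give conjugate values in pairs.\<close>

lemma det_circulant_8:
  fixes c :: "int \<Rightarrow> 'a::idom"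
  assumes sym: "c 3 = c 1" "c 7 = c 5" "c 6 = c 2"
  shows "det (circulant 8 c) =
    (c 0 + 2 * c 1 + 2 * c 2 + c 4 + 2 * c 5) * (c 0 - 2 * c 1 + 2 * c 2 + c 4 - 2 * c 5) *
    (c 0 - 2 * c 2 + c 4)\<^sup>2 * ((c 0 - c 4)\<^sup>2 + 2 * (c 1 - c 5)\<^sup>2)\<^sup>2"
proof -
  define U where "U = mat 4 4 (\<lambda>(i, j). c ((int i - int j) mod 8))"
  define V where "V = mat 4 4 (\<lambda>(i, j). c ((int i - int j + 4) mod 8))"
  have "circulant 8 c = four_block_mat U V V U"
  proof (rule eq_matI)
    fix i j assume "i < dim_row (four_block_mat U V V U)" "j < dim_col (four_block_mat U V V U)"
    then have "i \<in> {0,1,2,3,4,5,6,7}" "j \<in> {0,1,2,3,4,5,6,7}"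
      by (auto simp: U_def)
    then show "circulant 8 c $$ (i, j) = four_block_mat U V V U $$ (i, j)"
      by (elim insertE emptyE) (simp_all add: circulant_def U_def V_def)
  qed (simp_all add: circulant_def U_def)
  then have "det (circulant 8 c) = det (U + V) * det (U - V)"
    by (simp add: det_four_block_mat_symmetric[where n = 4] U_def V_def)
  moreover have "det (U + V) =
    (c 0 + 2 * c 1 + 2 * c 2 + c 4 + 2 * c 5) * (c 0 - 2 * c 1 + 2 * c 2 + c 4 - 2 * c 5) *
    (c 0 - 2 * c 2 + c 4)\<^sup>2"
    by (simp add: U_def V_def det_4 det_3 mat_delete_def sym power2_eq_square algebra_simps)
  moreover have "U - V =
      mat 4 4 (\<lambda>(i, j). c ((int i - int j) mod 8) - c ((int i - int j + 4) mod 8))"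
    by (rule eq_matI) (auto simp: U_def V_def)
  then have "det (U - V) = ((c 0 - c 4)\<^sup>2 + 2 * (c 1 - c 5)\<^sup>2)\<^sup>2"
    by (simp add: det_4 det_3 mat_delete_def sym) (simp add: power2_eq_square algebra_simps)
  ultimately show ?thesis by simp
qed

section \<open>The group determinant of the semidihedral group\<close>

definition sd16_elem :: "nat \<Rightarrow> bool \<Rightarrow> sd_gen gword set" where
  "sd16_elem i j = word_class sd16_relations (sd16_normal (i, j))"

text \<open>Acting on \<open>(0, False)\<close> reads off the normal form, whence injectivity;
  comparison with the order 16 shows that the normal forms exhaust the group.\<close>

lemma carrier_SD16: "carrier SD16 = (\<lambda>(i, j). sd16_elem i j) ` ({..<8} \<times> UNIV)"
  and inj_on_sd16_elem: "inj_on (\<lambda>(i, j). sd16_elem i j) ({..<8} \<times> UNIV)"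
proof -
  let ?N = "{..<8::nat} \<times> (UNIV :: bool set)" and ?e = "\<lambda>(i, j). sd16_elem i j"
  show inj: "inj_on ?e ?N"
  proof (rule inj_onI, clarify)
    fix i j i' j' assume i: "i < (8::nat)" "i' < (8::nat)" and "sd16_elem i j = sd16_elem i' j'"
    then have "word_cong sd16_relations (sd16_normal (i, j)) (sd16_normal (i', j'))"
      by (simp add: sd16_elem_def word_class_eq_iff)
    from sd16_act_cong[OF this, of "(0, False)"] show "i = i' \<and> j = j'"
      using i by (simp add: sd16_act_normal)
  qed
  have "?e ` ?N \<subseteq> carrier SD16"
    by (auto simp: SD16_def presented_group_def sd16_elem_def)
  moreover have "card (?e ` ?N) = card (carrier SD16)"
    using order_SD16 card_image[OF inj] by (simp add: Coset.order_def card_cartesian_product)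
  moreover have "finite (carrier SD16)"
    using order_SD16 by (intro card_ge_0_finite) (simp add: Coset.order_def)
  ultimately show "carrier SD16 = ?e ` ?N"
    using card_subset_eq by metis
qed

text \<open>A word and its normal form are congruent and so act alike on \<open>(0, False)\<close>;
  products can thus be computed by running the action.\<close>

lemma word_class_eq_sd16_elem:
  "word_class sd16_relations w = case_prod sd16_elem (foldr sd16_act w (0, False))"
proof -
  have "word_class sd16_relations w \<in> carrier SD16"
    by (simp add: SD16_def presented_group_def)
  then obtain i j where i: "i < 8" and w: "word_class sd16_relations w = sd16_elem i j"
    by (auto simp: carrier_SD16)
  then have "word_cong sd16_relations w (sd16_normal (i, j))"
    by (simp add: sd16_elem_def word_class_eq_iff)
  from sd16_act_cong[OF this, of "(0, False)"] show ?thesis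
    using i w by (simp add: sd16_act_normal)
qed

lemma sd16_act_sd16_normal:
  assumes "i < 8"
  shows "foldr sd16_act (sd16_normal (k, l)) (i, j) =
    (if l then ((k + 3 * i) mod 8, \<not> j) else ((k + i) mod 8, j))"
proof -
  have X: "foldr sd16_act (replicate k (GenX, True)) (i, j) = ((k + i) mod 8, j)" if "i < 8" for i j
    using that by (induction k) (auto simp: mod_Suc_eq)
  show ?thesis
    using X[OF assms] X[of "3 * i mod 8" "\<not> j"]
    by (auto simp: sd16_normal_def mod_simps)
qed

lemma sd16_elem_mult:
  assumes "i < 8"
  shows "sd16_elem k l \<otimes>\<^bsub>SD16\<^esub> sd16_elem i j =
    sd16_elem ((k + (if l then 3 * i else i)) mod 8) (l \<noteq> j)"
proof -
  have "sd16_elem k l \<otimes>\<^bsub>SD16\<^esub> sd16_elem i j =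
      word_class sd16_relations (sd16_normal (k, l) @ sd16_normal (i, j))"
    by (simp add: sd16_elem_def SD16_def presented_group_mult)
  also have "\<dots> = case_prod sd16_elem (foldr sd16_act (sd16_normal (k, l)) (i, j))"
    using assms by (simp add: word_class_eq_sd16_elem sd16_act_normal)
  also have "\<dots> = sd16_elem ((k + (if l then 3 * i else i)) mod 8) (l \<noteq> j)"
    using assms by (simp add: sd16_act_sd16_normal)
  finally show ?thesis .
qed

text \<open>Entries of the group matrix are quotients; each is checked by multiplying back, so no
  formula for inverses is involved.\<close>

lemma sd16_elem_mult_inv:
  assumes "i < 8" "k < 8" "m < 8" "(k + (if l then 3 * i else i)) mod 8 = m"
  shows "sd16_elem m (l \<noteq> j) \<otimes>\<^bsub>SD16\<^esub> inv\<^bsub>SD16\<^esub> sd16_elem i j = sd16_elem k l"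
proof -
  interpret group SD16 by (rule group_SD16)
  have "sd16_elem i' j' \<in> carrier SD16" if "i' < 8" for i' j'
    using that by (auto simp: carrier_SD16)
  then show ?thesis
    using assms sd16_elem_mult[of i k l j] inv_solve_right by metis
qed

text \<open>Listing the second coset as \<open>X^(3n) Y\<close> makes all four 8 by 8 blocks of the group matrix
  circulant, so that they commute.\<close>

definition sd16_enum :: "nat \<Rightarrow> sd_gen gword set" where
  "sd16_enum n = (if n < 8 then sd16_elem n False else sd16_elem (3 * n mod 8) True)"

lemma carrier_SD16_enum: "carrier SD16 = sd16_enum ` {0..<16}"
  and inj_on_sd16_enum: "inj_on sd16_enum {0..<16}"
proof -
  let ?b = "\<lambda>n::nat. if n < 8 then (n, False) else (3 * n mod 8, True)"
  have eq: "sd16_enum n = case_prod sd16_elem (?b n)" for n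
    by (simp add: sd16_enum_def)
  have inj: "inj_on ?b {0..<16}"
  proof (rule inj_onI)
    fix m n :: nat assume "m \<in> {0..<16}" "n \<in> {0..<16}" "?b m = ?b n"
    \<comment> \<open>Tripling is its own inverse modulo 8 because 9 is 1; adding 8 returns to the
      second half of the range.\<close>
    moreover have "k = (3 * (3 * k mod 8)) mod 8 + 8" if "8 \<le> k" "k < 16" for k :: nat
    proof -
      have "(3 * (3 * k mod 8)) mod 8 = (k + 8 * k) mod 8"
        by (simp add: mod_mult_right_eq)
      also have "\<dots> = k mod 8" by (rule mod_mult_self2)
      finally show ?thesis using le_mod_geq[OF that(1)] that by simp
    qed
    ultimately show "m = n"
      by (metis Pair_inject atLeastLessThan_iff not_less)
  qed
  have sub: "?b ` {0..<16} \<subseteq> {..<8} \<times> UNIV" by auto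
  have "card (?b ` {0..<16}) = card ({..<8::nat} \<times> (UNIV::bool set))"
    using card_image[OF inj] by (simp add: card_cartesian_product)
  then have img: "?b ` {0..<16} = {..<8} \<times> UNIV"
    by (intro card_subset_eq sub) auto
  show "carrier SD16 = sd16_enum ` {0..<16}"
    unfolding carrier_SD16 img[symmetric] image_image eq ..
  have "sd16_enum = case_prod sd16_elem \<circ> ?b" using eq by (auto simp: fun_eq_iff)
  moreover have "inj_on (case_prod sd16_elem \<circ> ?b) {0..<16}"
    by (rule comp_inj_on[OF inj]) (unfold img, rule inj_on_sd16_elem)
  ultimately show "inj_on sd16_enum {0..<16}" by (simp only:)
qed

text \<open>For a primitive eighth root of unity \<open>\<zeta>\<close> and \<open>f(x) = \<Sum>i<8. f i * x^i\<close> one has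
  \<open>f(\<zeta>) f(\<zeta>^3) = sd16_norm_A f + sd16_norm_B f * sqrt (-2)\<close>, where \<open>sqrt (-2) = \<zeta> + \<zeta>^3\<close>.\<close>

definition sd16_norm_A :: "(nat \<Rightarrow> int) \<Rightarrow> int" where
  "sd16_norm_A f = (f 0 - f 4)\<^sup>2 - (f 1 - f 5)\<^sup>2 + (f 2 - f 6)\<^sup>2 - (f 3 - f 7)\<^sup>2"

definition sd16_norm_B :: "(nat \<Rightarrow> int) \<Rightarrow> int" where
  "sd16_norm_B f = (f 0 - f 4) * (f 1 - f 5 + f 3 - f 7) + (f 2 - f 6) * (f 3 - f 7 - f 1 + f 5)"

text \<open>The first two factors come from the four linear characters, the third from the
  two-dimensional representation with \<open>X \<mapsto> diag(i, -i)\<close> and the last from the two conjugate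
  faithful ones. Only the values of \<open>f\<close> and \<open>g\<close> below 8 matter.\<close>

definition sd16_det :: "(nat \<Rightarrow> int) \<Rightarrow> (nat \<Rightarrow> int) \<Rightarrow> int" where
  "sd16_det f g =
    ((f 0 + f 1 + f 2 + f 3 + f 4 + f 5 + f 6 + f 7)\<^sup>2 -
      (g 0 + g 1 + g 2 + g 3 + g 4 + g 5 + g 6 + g 7)\<^sup>2) *
    ((f 0 - f 1 + f 2 - f 3 + f 4 - f 5 + f 6 - f 7)\<^sup>2 -
      (g 0 - g 1 + g 2 - g 3 + g 4 - g 5 + g 6 - g 7)\<^sup>2) *
    ((f 0 - f 2 + f 4 - f 6)\<^sup>2 + (f 1 - f 3 + f 5 - f 7)\<^sup>2 -
     (g 0 - g 2 + g 4 - g 6)\<^sup>2 - (g 1 - g 3 + g 5 - g 7)\<^sup>2)\<^sup>2 *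
    ((sd16_norm_A f - sd16_norm_A g)\<^sup>2 + 2 * (sd16_norm_B f - sd16_norm_B g)\<^sup>2)\<^sup>2"

section \<open>Evaluation and factorisation of the group determinant\<close>

text \<open>Here \<open>h\<close> holds the coefficients of \<open>c(x) c(x^3)\<close> modulo
  \<open>x^8 - 1\<close>, invariant under \<open>x \<mapsto> x^3\<close> since 9 is 1 modulo 8. The
  formulas are its values at 1, -1 and i and its two coordinates at a primitive eighth root of
  unity.\<close>

lemma cyclic_conv_8_twisted:
  fixes c :: "int \<Rightarrow> int"
  defines "h \<equiv> cyclic_conv 8 c (\<lambda>k. c (3 * k mod 8))"
  shows "h 3 = h 1" "h 7 = h 5" "h 6 = h 2"
    and "h 0 + 2 * h 1 + 2 * h 2 + h 4 + 2 * h 5 =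
      (c 0 + c 1 + c 2 + c 3 + c 4 + c 5 + c 6 + c 7)\<^sup>2"
    and "h 0 - 2 * h 1 + 2 * h 2 + h 4 - 2 * h 5 =
      (c 0 - c 1 + c 2 - c 3 + c 4 - c 5 + c 6 - c 7)\<^sup>2"
    and "h 0 - 2 * h 2 + h 4 = (c 0 - c 2 + c 4 - c 6)\<^sup>2 + (c 1 - c 3 + c 5 - c 7)\<^sup>2"
    and "h 0 - h 4 = (c 0 - c 4)\<^sup>2 - (c 1 - c 5)\<^sup>2 + (c 2 - c 6)\<^sup>2 - (c 3 - c 7)\<^sup>2"
    and "h 1 - h 5 =
      (c 0 - c 4) * (c 1 - c 5 + c 3 - c 7) + (c 2 - c 6) * (c 3 - c 7 - c 1 + c 5)"
proof -
  have "{0..<8::int} = {0, 1, 2, 3, 4, 5, 6, 7}" by auto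
  then have h: "h k = c 0 * c (3 * (k mod 8) mod 8) + c 1 * c (3 * ((k - 1) mod 8) mod 8) +
      c 2 * c (3 * ((k - 2) mod 8) mod 8) + c 3 * c (3 * ((k - 3) mod 8) mod 8) +
      c 4 * c (3 * ((k - 4) mod 8) mod 8) + c 5 * c (3 * ((k - 5) mod 8) mod 8) +
      c 6 * c (3 * ((k - 6) mod 8) mod 8) + c 7 * c (3 * ((k - 7) mod 8) mod 8)" for k
    by (simp add: h_def cyclic_conv_def)
  show "h 3 = h 1" "h 7 = h 5" "h 6 = h 2"
    by (simp_all add: h)
  show "h 0 + 2 * h 1 + 2 * h 2 + h 4 + 2 * h 5 =
      (c 0 + c 1 + c 2 + c 3 + c 4 + c 5 + c 6 + c 7)\<^sup>2"
    by (simp add: h power2_eq_square algebra_simps)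
  show "h 0 - 2 * h 1 + 2 * h 2 + h 4 - 2 * h 5 =
      (c 0 - c 1 + c 2 - c 3 + c 4 - c 5 + c 6 - c 7)\<^sup>2"
    by (simp add: h power2_eq_square algebra_simps)
  show "h 0 - 2 * h 2 + h 4 = (c 0 - c 2 + c 4 - c 6)\<^sup>2 + (c 1 - c 3 + c 5 - c 7)\<^sup>2"
    by (simp add: h power2_eq_square algebra_simps)
  show "h 0 - h 4 = (c 0 - c 4)\<^sup>2 - (c 1 - c 5)\<^sup>2 + (c 2 - c 6)\<^sup>2 - (c 3 - c 7)\<^sup>2"
    by (simp add: h power2_eq_square algebra_simps)
  show "h 1 - h 5 =
      (c 0 - c 4) * (c 1 - c 5 + c 3 - c 7) + (c 2 - c 6) * (c 3 - c 7 - c 1 + c 5)"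
    by (simp add: h power2_eq_square algebra_simps)
qed

text \<open>The blocks of the group matrix are the circulants of \<open>f\<close>, \<open>g\<close>,
  \<open>g3\<close>, \<open>f3\<close>, where the suffix 3 marks the substitution
  \<open>x \<mapsto> x^3\<close> caused by \<open>Y X = X^3 Y\<close>.\<close>

lemma group_det_SD16:
  "group_det SD16 a = sd16_det (\<lambda>i. a (sd16_elem i False)) (\<lambda>i. a (sd16_elem i True))"
proof -
  define f where "f k = a (sd16_elem (nat k) False)" for k
  define g where "g k = a (sd16_elem (nat k) True)" for k
  define f3 where "f3 k = f (3 * k mod 8)" for k
  define g3 where "g3 k = g (3 * k mod 8)" for k
  define h where "h k = cyclic_conv 8 f f3 k - cyclic_conv 8 g g3 k" for k
  let ?M = "mat 16 16 (\<lambda>(i, j). a (sd16_enum i \<otimes>\<^bsub>SD16\<^esub> inv\<^bsub>SD16\<^esub> sd16_enum j))"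
  have entry: "a (sd16_enum i \<otimes>\<^bsub>SD16\<^esub> inv\<^bsub>SD16\<^esub> sd16_enum j) =
      (let d = (int i - int j) mod 8 in
        if i < 8 then if j < 8 then f d else g d else if j < 8 then g3 d else f3 d)"
    if "i < 16" "j < 16" for i j
  proof -
    let ?d = "nat ((int i - int j) mod 8)"
    let ?d3 = "nat (3 * ((int i - int j) mod 8) mod 8)"
    \<comment> \<open>Moving \<open>Y\<close> past \<open>X^(3 y)\<close> gives
      \<open>X^(9 y)\<close>, which is \<open>X^y\<close>.\<close>
    have twist: "((x - y) mod 8 + 3 * (3 * y mod 8)) mod 8 = x mod 8" for x y :: int
    proof -
      have "((x - y) mod 8 + 3 * (3 * y mod 8)) mod 8 = ((x - y) + 3 * (3 * y)) mod 8"
        by (intro mod_add_cong mod_mult_cong) simp_all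
      also have "(x - y) + 3 * (3 * y) = x + 8 * y" by simp
      finally show ?thesis by simp
    qed
    have "sd16_elem i False \<otimes>\<^bsub>SD16\<^esub> inv\<^bsub>SD16\<^esub> sd16_elem j False = sd16_elem ?d False"
      if "i < 8" "j < 8"
    proof -
      have "int ((?d + j) mod 8) = int i"
        using that by (simp add: zmod_int mod_simps algebra_simps)
      then have "(?d + j) mod 8 = i" by (simp only: of_nat_eq_iff)
      then show ?thesis using sd16_elem_mult_inv[of j ?d i False False] that by simp
    qed
    moreover have "sd16_elem i False \<otimes>\<^bsub>SD16\<^esub> inv\<^bsub>SD16\<^esub> sd16_elem (3 * j mod 8) True = sd16_elem ?d True"
      if "i < 8" 
    proof -
      have "int ((?d + 3 * (3 * j mod 8)) mod 8) = int i"
        using that twist[of "int i" "int j"] by (simp add: zmod_int mod_simps)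
      then have "(?d + 3 * (3 * j mod 8)) mod 8 = i" by (simp only: of_nat_eq_iff)
      then show ?thesis using sd16_elem_mult_inv[of "3 * j mod 8" ?d i True True] that by simp
    qed
    moreover have "sd16_elem (3 * i mod 8) True \<otimes>\<^bsub>SD16\<^esub> inv\<^bsub>SD16\<^esub> sd16_elem j False = sd16_elem ?d3 True"
      if "j < 8" 
    proof -
      have "int ((?d3 + 3 * j) mod 8) = int (3 * i mod 8)"
        using that by (simp add: zmod_int mod_simps algebra_simps)
      then have "(?d3 + 3 * j) mod 8 = 3 * i mod 8" by (simp only: of_nat_eq_iff)
      then show ?thesis using sd16_elem_mult_inv[of j ?d3 "3 * i mod 8" True False] that by simp
    qed
    moreover have "sd16_elem (3 * i mod 8) True \<otimes>\<^bsub>SD16\<^esub> inv\<^bsub>SD16\<^esub> sd16_elem (3 * j mod 8) True = sd16_elem ?d3 False"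
    proof -
      have "int ((?d3 + 3 * j mod 8) mod 8) = int (3 * i mod 8)"
        by (simp add: zmod_int mod_simps algebra_simps)
      then have "(?d3 + 3 * j mod 8) mod 8 = 3 * i mod 8" by (simp only: of_nat_eq_iff)
      then show ?thesis using sd16_elem_mult_inv[of "3 * j mod 8" ?d3 "3 * i mod 8" False True] by simp
    qed
    ultimately show ?thesis
      by (simp add: sd16_enum_def Let_def f_def g_def f3_def g3_def)
  qed
  have "?M = four_block_mat (circulant 8 f) (circulant 8 g) (circulant 8 g3) (circulant 8 f3)"
  proof (rule eq_matI)
    fix i j
    assume "i < dim_row (four_block_mat (circulant 8 f) (circulant 8 g) (circulant 8 g3) (circulant 8 f3))"
      "j < dim_col (four_block_mat (circulant 8 f) (circulant 8 g) (circulant 8 g3) (circulant 8 f3))"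
    then have i: "i < 16" and j: "j < 16" by (auto simp: circulant_def)
    \<comment> \<open>Inside a block the indices start again at 0; the shift by 8 vanishes modulo
      8.\<close>
    have "(int i - int j) mod 8 = (int (i - 8) - int (j - 8)) mod 8" if "\<not> i < 8" "\<not> j < 8"
      using that by (simp add: of_nat_diff mod_eq_dvd_iff)
    moreover have "(int i - int j) mod 8 = (int i - int (j - 8)) mod 8" if "\<not> j < 8"
      using that by (simp add: of_nat_diff mod_eq_dvd_iff)
    moreover have "(int i - int j) mod 8 = (int (i - 8) - int j) mod 8" if "\<not> i < 8"
      using that by (simp add: of_nat_diff mod_eq_dvd_iff)
    ultimately show "?M $$ (i, j) =
        four_block_mat (circulant 8 f) (circulant 8 g) (circulant 8 g3) (circulant 8 f3) $$ (i, j)"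
      using i j by (simp add: entry circulant_def Let_def)
  qed (simp_all add: circulant_def)
  moreover have "det (four_block_mat (circulant 8 f) (circulant 8 g) (circulant 8 g3) (circulant 8 f3)) =
      det (circulant 8 f * circulant 8 f3 - circulant 8 g * circulant 8 g3)"
    by (rule det_four_block_mat[OF _ _ _ _ circulant_mult_commute]) (rule circulant_carrier)+
  moreover have "group_det SD16 a = det ?M"
    unfolding group_det_def carrier_SD16_enum by (rule det_on_image_eq_det[OF inj_on_sd16_enum])
  ultimately have M: "group_det SD16 a = det (circulant 8 h)"
    by (simp add: circulant_mult circulant_diff h_def[abs_def])
  note F = cyclic_conv_8_twisted[of f, folded f3_def]
  note G = cyclic_conv_8_twisted[of g, folded g3_def]
  have "h 3 = h 1" "h 7 = h 5" "h 6 = h 2"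
    using F(1-3) G(1-3) by (simp_all add: h_def)
  note D = det_circulant_8[OF this]
  have h1: "h 0 + 2 * h 1 + 2 * h 2 + h 4 + 2 * h 5 =
      (f 0 + f 1 + f 2 + f 3 + f 4 + f 5 + f 6 + f 7)\<^sup>2 -
      (g 0 + g 1 + g 2 + g 3 + g 4 + g 5 + g 6 + g 7)\<^sup>2"
    unfolding F(4)[symmetric] G(4)[symmetric] h_def by simp
  have h2: "h 0 - 2 * h 1 + 2 * h 2 + h 4 - 2 * h 5 =
      (f 0 - f 1 + f 2 - f 3 + f 4 - f 5 + f 6 - f 7)\<^sup>2 -
      (g 0 - g 1 + g 2 - g 3 + g 4 - g 5 + g 6 - g 7)\<^sup>2"
    unfolding F(5)[symmetric] G(5)[symmetric] h_def by simp
  have h3: "h 0 - 2 * h 2 + h 4 = ((f 0 - f 2 + f 4 - f 6)\<^sup>2 + (f 1 - f 3 + f 5 - f 7)\<^sup>2) -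
     ((g 0 - g 2 + g 4 - g 6)\<^sup>2 + (g 1 - g 3 + g 5 - g 7)\<^sup>2)"
    unfolding F(6)[symmetric] G(6)[symmetric] h_def by simp
  have h4: "h 0 - h 4 = sd16_norm_A (\<lambda>i. f (int i)) - sd16_norm_A (\<lambda>i. g (int i))"
    unfolding sd16_norm_A_def of_nat_0 of_nat_1 of_nat_numeral F(7)[symmetric] G(7)[symmetric] h_def
    by simp
  have h5: "h 1 - h 5 = sd16_norm_B (\<lambda>i. f (int i)) - sd16_norm_B (\<lambda>i. g (int i))"
    unfolding sd16_norm_B_def of_nat_0 of_nat_1 of_nat_numeral F(8)[symmetric] G(8)[symmetric] h_def
    by simp
  have "group_det SD16 a = sd16_det (\<lambda>i. f (int i)) (\<lambda>i. g (int i))"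
    unfolding M D h1 h2 h3 h4 h5 sd16_det_def of_nat_0 of_nat_1 of_nat_numeral diff_diff_eq ..
  then show ?thesis by (simp add: f_def g_def)
qed

text \<open>Normal forms are pairwise distinct, so their sixteen coefficients can be prescribed
  freely.\<close>

lemma integer_group_determinants_SD16: "integer_group_determinants SD16 = {sd16_det f g | f g. True}"
proof -
  have "sd16_det f g \<in> range (group_det SD16)" for f g
  proof -
    let ?N = "{..<8::nat} \<times> (UNIV :: bool set)" and ?e = "\<lambda>(i, j). sd16_elem i j"
    define a where "a x = (case inv_into ?N ?e x of (i, j) \<Rightarrow> if j then g i else f i)" for x
    have a: "a (sd16_elem i j) = (if j then g i else f i)" if "i < 8" for i j
      using that inv_into_f_f[OF inj_on_sd16_elem, of "(i, j)"] by (simp add: a_def)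
    have "a (sd16_elem 0 False) = f 0" "a (sd16_elem 1 False) = f 1" "a (sd16_elem 2 False) = f 2"
      "a (sd16_elem 3 False) = f 3" "a (sd16_elem 4 False) = f 4" "a (sd16_elem 5 False) = f 5"
      "a (sd16_elem 6 False) = f 6" "a (sd16_elem 7 False) = f 7" "a (sd16_elem 0 True) = g 0"
      "a (sd16_elem 1 True) = g 1" "a (sd16_elem 2 True) = g 2" "a (sd16_elem 3 True) = g 3"
      "a (sd16_elem 4 True) = g 4" "a (sd16_elem 5 True) = g 5" "a (sd16_elem 6 True) = g 6"
      "a (sd16_elem 7 True) = g 7"
      by (simp_all add: a)
    then have "group_det SD16 a = sd16_det f g"
      unfolding group_det_SD16 sd16_det_def sd16_norm_A_def sd16_norm_B_def by (simp only:)
    then show ?thesis by (metis rangeI)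
  qed
  then show ?thesis
    by (auto simp: integer_group_determinants_def group_det_SD16)
qed

section \<open>Values of the determinant\<close>

text \<open>Here \<open>e, d\<close> (resp. \<open>e', d'\<close>) are the sums of the coefficients of \<open>f\<close> (resp. \<open>g\<close>) with even
  and with odd index; the 2-adic analysis needs nothing else.\<close>

lemma sd16_det_reduced:
  "\<exists>e d e' d' R S T. sd16_det f g =
    ((e + d)\<^sup>2 - (e' + d')\<^sup>2) * ((e - d)\<^sup>2 - (e' - d')\<^sup>2) *
    (e\<^sup>2 + d\<^sup>2 - e'\<^sup>2 - d'\<^sup>2 + 4 * R)\<^sup>2 *
    ((e + d + e' + d' + 2 * S)\<^sup>2 + 2 * (e * d + e' * d' + 2 * T)\<^sup>2)\<^sup>2"
proof -
  define Ev where "Ev c = c 0 + c 2 + c 4 + c 6" for c :: "nat \<Rightarrow> int"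
  define Od where "Od c = c 1 + c 3 + c 5 + c 7" for c :: "nat \<Rightarrow> int"
  have A: "\<exists>S. sd16_norm_A c = Ev c + Od c + 2 * S" for c
  proof -
    have sq: "even (x\<^sup>2 - x)" for x :: int by simp
    have "even (((c 0 - c 4)\<^sup>2 - (c 0 - c 4)) - ((c 1 - c 5)\<^sup>2 - (c 1 - c 5)) +
        ((c 2 - c 6)\<^sup>2 - (c 2 - c 6)) - ((c 3 - c 7)\<^sup>2 - (c 3 - c 7)) -
        2 * (c 4 + c 1 + c 6 + c 3))"
      by (simp only: sq dvd_add dvd_diff dvd_triv_left)
    also have "((c 0 - c 4)\<^sup>2 - (c 0 - c 4)) - ((c 1 - c 5)\<^sup>2 - (c 1 - c 5)) +
        ((c 2 - c 6)\<^sup>2 - (c 2 - c 6)) - ((c 3 - c 7)\<^sup>2 - (c 3 - c 7)) -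
        2 * (c 4 + c 1 + c 6 + c 3) = sd16_norm_A c - (Ev c + Od c)"
      by (simp add: sd16_norm_A_def Ev_def Od_def)
    finally obtain S where "sd16_norm_A c - (Ev c + Od c) = 2 * S" by (elim evenE)
    then show ?thesis by (intro exI[of _ S]) simp
  qed
  have B: "\<exists>T. sd16_norm_B c = Ev c * Od c + 2 * T" for c
    \<comment> \<open>With a, b, u, v for \<open>c 0 - c 4\<close>, \<open>c 2 - c 6\<close>,
      \<open>c 1 - c 5\<close>, \<open>c 3 - c 7\<close>, the norm is
      \<open>(a + b) * (u + v) - 2 * b * u\<close>, where
      \<open>a + b = Ev c - 2 * (c 4 + c 6)\<close> and
      \<open>u + v = Od c - 2 * (c 5 + c 7)\<close>.\<close>
    by (rule exI[of _ "2 * (c 4 + c 6) * (c 5 + c 7) - (c 1 - c 5) * (c 2 - c 6)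
          - (c 4 + c 6) * Od c - Ev c * (c 5 + c 7)"])
      (simp add: sd16_norm_B_def Ev_def Od_def algebra_simps)
  have C: "\<exists>R. (c 0 - c 2 + c 4 - c 6)\<^sup>2 + (c 1 - c 3 + c 5 - c 7)\<^sup>2 = (Ev c)\<^sup>2 + (Od c)\<^sup>2 + 4 * R" for c
    by (rule exI[of _ "(c 2 + c 6)\<^sup>2 - Ev c * (c 2 + c 6) + (c 3 + c 7)\<^sup>2 - Od c * (c 3 + c 7)"])
      (simp add: Ev_def Od_def power2_eq_square algebra_simps)
  obtain Sf Sg Tf Tg Rf Rg where
    A': "sd16_norm_A f = Ev f + Od f + 2 * Sf" "sd16_norm_A g = Ev g + Od g + 2 * Sg" and
    B': "sd16_norm_B f = Ev f * Od f + 2 * Tf" "sd16_norm_B g = Ev g * Od g + 2 * Tg" and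
    C': "(f 0 - f 2 + f 4 - f 6)\<^sup>2 + (f 1 - f 3 + f 5 - f 7)\<^sup>2 = (Ev f)\<^sup>2 + (Od f)\<^sup>2 + 4 * Rf"
      "(g 0 - g 2 + g 4 - g 6)\<^sup>2 + (g 1 - g 3 + g 5 - g 7)\<^sup>2 = (Ev g)\<^sup>2 + (Od g)\<^sup>2 + 4 * Rg"
    using A B C by metis
  \<comment> \<open>Signs are flipped at the cost of an even term, making the expressions symmetric
    in \<open>f\<close> and \<open>g\<close>.\<close>
  have "sd16_norm_A f - sd16_norm_A g = Ev f + Od f + Ev g + Od g + 2 * (Sf - Sg - Ev g - Od g)"
    using A' by simp
  moreover have "sd16_norm_B f - sd16_norm_B g = Ev f * Od f + Ev g * Od g + 2 * (Tf - Tg - Ev g * Od g)"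
    using B' by simp
  moreover have "(f 0 - f 2 + f 4 - f 6)\<^sup>2 + (f 1 - f 3 + f 5 - f 7)\<^sup>2 -
      (g 0 - g 2 + g 4 - g 6)\<^sup>2 - (g 1 - g 3 + g 5 - g 7)\<^sup>2 =
      (Ev f)\<^sup>2 + (Od f)\<^sup>2 - (Ev g)\<^sup>2 - (Od g)\<^sup>2 + 4 * (Rf - Rg)"
    using C' by simp
  moreover have "c 0 + c 1 + c 2 + c 3 + c 4 + c 5 + c 6 + c 7 = Ev c + Od c"
    "c 0 - c 1 + c 2 - c 3 + c 4 - c 5 + c 6 - c 7 = Ev c - Od c" for c
    by (simp_all add: Ev_def Od_def)
  ultimately show ?thesis
    unfolding sd16_det_def by metis
qed

section \<open>Constraints on the values modulo powers of 2\<close>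

text \<open>Odd squares are 1 modulo 8, so \<open>D\<close> is \<open>1 - 4 * (m^2 + n^2)\<close>
  there, with \<open>m + n = e'\<close>. The value 5 needs \<open>e'\<close> odd; then
  \<open>d'\<close> is odd too, while \<open>e * d\<close> is even, so the second square in
  \<open>N\<close> is odd.\<close>

lemma reduced_value_odd:
  fixes e d e' d' R S T D N :: int
  assumes N: "N = (e + d + e' + d' + 2 * S)\<^sup>2 + 2 * (e * d + e' * d' + 2 * T)\<^sup>2"
    and D: "D = ((e + d)\<^sup>2 - (e' + d')\<^sup>2) * ((e - d)\<^sup>2 - (e' - d')\<^sup>2) *
      (e\<^sup>2 + d\<^sup>2 - e'\<^sup>2 - d'\<^sup>2 + 4 * R)\<^sup>2 * N\<^sup>2"
    and odd: "odd (e + d)" and even: "even (e' + d')"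
  shows "[D = 1] (mod 8) \<or> [D = 5] (mod 8) \<and> N mod 8 = 3"
proof -
  obtain m where m: "e' + d' = 2 * m" using even by (elim evenE)
  define n where "n = m - d'"
  have n: "e' - d' = 2 * n" and e': "e' = m + n" using m by (simp_all add: n_def)
  have sq: "[x\<^sup>2 = 1] (mod 8)" if "odd x" for x :: int
    using odd_square_mod_8[OF that] by (simp add: cong_def)
  have c8: "[c + 8 * x = c] (mod 8)" for c x :: int
    by (simp add: cong_iff_dvd_diff)
  have oddN: "odd N" unfolding N using odd even by simp
  have "odd (e - d)" using odd by simp
  have "odd (e\<^sup>2 + d\<^sup>2 - e'\<^sup>2 - d'\<^sup>2 + 4 * R)" using odd even by simp
  then have "[D = (1 - (2 * m)\<^sup>2) * (1 - (2 * n)\<^sup>2) * 1 * 1] (mod 8)"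
    unfolding D m n using odd \<open>odd (e - d)\<close> oddN
    by (intro cong_mult cong_diff cong_refl sq)
  also have "(1 - (2 * m)\<^sup>2) * (1 - (2 * n)\<^sup>2) * 1 * 1 = 1 - 4 * (m\<^sup>2 + n\<^sup>2) + 8 * (2 * m\<^sup>2 * n\<^sup>2)"
    by (simp add: power2_eq_square algebra_simps)
  finally have D8: "[D = 1 - 4 * (m\<^sup>2 + n\<^sup>2) + 8 * (2 * m\<^sup>2 * n\<^sup>2)] (mod 8)" .
  show ?thesis
  proof (cases "even e'")
    case True
    then have "even (m\<^sup>2 + n\<^sup>2)" by (simp add: e')
    then obtain k where "m\<^sup>2 + n\<^sup>2 = 2 * k" by (elim evenE)
    then have "[D = 1 + 8 * (2 * m\<^sup>2 * n\<^sup>2 - k)] (mod 8)" using D8 by (simp add: algebra_simps)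
    then have "[D = 1] (mod 8)" using c8 by (rule cong_trans)
    then show ?thesis ..
  next
    case False
    then have "odd (m\<^sup>2 + n\<^sup>2)" by (simp add: e')
    then obtain k where "m\<^sup>2 + n\<^sup>2 = 2 * k + 1" by (elim oddE)
    then have "[D = 5 + 8 * (2 * m\<^sup>2 * n\<^sup>2 - k - 1)] (mod 8)" using D8 by (simp add: algebra_simps)
    then have "[D = 5] (mod 8)" using c8 by (rule cong_trans)
    moreover have "odd (e * d + e' * d' + 2 * T)" using False even odd by auto
    then have "N mod 8 = 3"
      using odd_form_mod_8[OF oddN[unfolded N]] unfolding N
      by (simp only: not_False_eq_True if_True)
    ultimately show ?thesis by blast
  qed
qed

text \<open>\<open>P\<close> and \<open>N\<close> are even and contribute \<open>2^4\<close>, so 64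
  from the first two factors suffices. If \<open>e + d\<close> is odd, each is a difference of odd
  squares, divisible by 8. If all four parameters have equal parity, 4 divides both factors,
  \<open>P\<close> and \<open>N\<close>, giving \<open>2^12\<close>. Otherwise the halved sums and
  differences supply the missing power.\<close>

lemma reduced_value_even:
  fixes e d e' d' R S T D N P :: int
  assumes N: "N = (e + d + e' + d' + 2 * S)\<^sup>2 + 2 * (e * d + e' * d' + 2 * T)\<^sup>2"
    and P: "P = e\<^sup>2 + d\<^sup>2 - e'\<^sup>2 - d'\<^sup>2 + 4 * R"
    and D: "D = ((e + d)\<^sup>2 - (e' + d')\<^sup>2) * ((e - d)\<^sup>2 - (e' - d')\<^sup>2) * P\<^sup>2 * N\<^sup>2"
    and ev: "even (e + d + e' + d')"
  shows "2 ^ 10 dvd D"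
proof -
  have N2: "2 dvd N" unfolding N using ev by simp
  have P2: "2 dvd P" unfolding P using ev by simp
  have sq4: "2\<^sup>2 dvd N\<^sup>2" "2\<^sup>2 dvd P\<^sup>2"
    using N2 P2 by (intro dvd_power_same; simp)+
  have fin: "2 ^ 10 dvd D" if "64 dvd ((e + d)\<^sup>2 - (e' + d')\<^sup>2) * ((e - d)\<^sup>2 - (e' - d')\<^sup>2)"
  proof -
    have "64 * 2\<^sup>2 * 2\<^sup>2 dvd D" unfolding D using that sq4 by (intro mult_dvd_mono)
    then show ?thesis by simp
  qed
  have par: "4 dvd x\<^sup>2 - y\<^sup>2" if "even (x - y)" for x y :: int
  proof -
    have "2 * 2 dvd (x - y) * (x + y)" using that by (intro mult_dvd_mono) auto
    then show ?thesis by (simp add: power2_eq_square algebra_simps)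
  qed
  show ?thesis
  proof (cases "even (e + d)")
    case False
    have odd8: "8 dvd x\<^sup>2 - y\<^sup>2" if "odd x" "odd y" for x y :: int
      using odd_square_mod_8[OF that(1)] odd_square_mod_8[OF that(2)]
      by (metis mod_eq_dvd_iff)
    have "8 * 8 dvd ((e + d)\<^sup>2 - (e' + d')\<^sup>2) * ((e - d)\<^sup>2 - (e' - d')\<^sup>2)"
      using False ev by (intro mult_dvd_mono odd8) auto
    then show ?thesis using fin by simp
  next
    case True
    then have True': "even (e' + d')" using ev by simp
    show ?thesis
    proof (cases "even (e + e')")
      case same: True
      have "even (e - e')" "even (d - d')" using same True True' by auto
      then have "4 dvd (e\<^sup>2 - e'\<^sup>2) + (d\<^sup>2 - d'\<^sup>2) + 4 * R" by (intro dvd_add par) simp_all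
      then have "4 dvd P" unfolding P by (simp add: algebra_simps)
      then have P4: "4\<^sup>2 dvd P\<^sup>2" by (rule dvd_power_same)
      have "2 dvd e * d + e' * d' + 2 * T" using same True True' by auto
      then have "2\<^sup>2 dvd (e * d + e' * d' + 2 * T)\<^sup>2" by (rule dvd_power_same)
      moreover have "2\<^sup>2 dvd (e + d + e' + d' + 2 * S)\<^sup>2"
        using ev by (intro dvd_power_same) simp
      ultimately have "2\<^sup>2 dvd N" unfolding N by (intro dvd_add dvd_mult) 
      then have N4: "(2\<^sup>2)\<^sup>2 dvd N\<^sup>2" by (rule dvd_power_same)
      have "4 * 4 * 4\<^sup>2 * (2\<^sup>2)\<^sup>2 dvd D" unfolding D
        using True True' P4 N4 by (intro mult_dvd_mono par) auto
      then have "(4 * 4 * 4\<^sup>2 * (2\<^sup>2)\<^sup>2 :: int) dvd D" .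
      moreover have "(2 ^ 10 :: int) dvd 4 * 4 * 4\<^sup>2 * (2\<^sup>2)\<^sup>2" by simp
      ultimately show ?thesis using dvd_trans by blast
    next
      case diff: False
      obtain m where m: "e + d = 2 * m" using True by (elim evenE)
      obtain m' where m': "e' + d' = 2 * m'" using True' by (elim evenE)
      define n n' where "n = m - d" and "n' = m' - d'"
      have n: "e - d = 2 * n" "e = m + n" and n': "e' - d' = 2 * n'" "e' = m' + n'"
        using m m' by (simp_all add: n_def n'_def)
      have "m + n + m' + n' = e + e'" using n(2) n'(2) by simp
      then have "odd (m + n + m' + n')" using diff by (simp only: not_False_eq_True)
      \<comment> \<open>The two differences have odd sum, so one is even and its difference of
        squares is divisible by 4.\<close>
      then have "even (m - m') \<or> even (n - n')" by auto
      then have "4 dvd (m\<^sup>2 - m'\<^sup>2) * (n\<^sup>2 - n'\<^sup>2)" using par by (metis dvd_mult dvd_mult2)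
      then have "16 * 4 dvd 16 * ((m\<^sup>2 - m'\<^sup>2) * (n\<^sup>2 - n'\<^sup>2))" by (intro mult_dvd_mono) simp_all
      also have "16 * ((m\<^sup>2 - m'\<^sup>2) * (n\<^sup>2 - n'\<^sup>2)) =
          ((e + d)\<^sup>2 - (e' + d')\<^sup>2) * ((e - d)\<^sup>2 - (e' - d')\<^sup>2)"
        unfolding m m' n(1) n'(1) by (simp add: power2_eq_square algebra_simps)
      finally show ?thesis using fin by simp
    qed
  qed
qed

text \<open>The parity of \<open>e + d + e' + d'\<close> decides that of the determinant: an even
  sum forces \<open>2 ^ 10\<close>, an odd one a residue 1 or 5 modulo 8.\<close>

lemma sd16_det_even: "even (sd16_det f g) \<Longrightarrow> 2 ^ 10 dvd sd16_det f g"
  and sd16_det_odd: "odd (sd16_det f g) \<Longrightarrow> [sd16_det f g = 1] (mod 8) \<or>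
    [sd16_det f g = 5] (mod 8) \<and>
      (\<exists>m p. [m = 5] (mod 8) \<and> prime p \<and> [p = 3] (mod 8) \<and> sd16_det f g = m * p\<^sup>2)"
proof -
  define D where "D = sd16_det f g"
  obtain e d e' d' R S T where D0: "D =
    ((e + d)\<^sup>2 - (e' + d')\<^sup>2) * ((e - d)\<^sup>2 - (e' - d')\<^sup>2) *
    (e\<^sup>2 + d\<^sup>2 - e'\<^sup>2 - d'\<^sup>2 + 4 * R)\<^sup>2 *
    ((e + d + e' + d' + 2 * S)\<^sup>2 + 2 * (e * d + e' * d' + 2 * T)\<^sup>2)\<^sup>2"
    using sd16_det_reduced[of f g] unfolding D_def by blast
  define N where N: "N = (e + d + e' + d' + 2 * S)\<^sup>2 + 2 * (e * d + e' * d' + 2 * T)\<^sup>2"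
  have D1: "D = ((e + d)\<^sup>2 - (e' + d')\<^sup>2) * ((e - d)\<^sup>2 - (e' - d')\<^sup>2) *
    (e\<^sup>2 + d\<^sup>2 - e'\<^sup>2 - d'\<^sup>2 + 4 * R)\<^sup>2 * N\<^sup>2"
    using D0 N by simp
  \<comment> \<open>Exchanging \<open>f\<close> and \<open>g\<close> negates the first two factors
    and preserves the squares, so \<open>e + d\<close> may be taken odd in the odd case.\<close>
  have D2: "D = ((e' + d')\<^sup>2 - (e + d)\<^sup>2) * ((e' - d')\<^sup>2 - (e - d)\<^sup>2) *
    (e'\<^sup>2 + d'\<^sup>2 - e\<^sup>2 - d\<^sup>2 + 4 * (- R))\<^sup>2 * N\<^sup>2"
  proof -
    have "e'\<^sup>2 + d'\<^sup>2 - e\<^sup>2 - d\<^sup>2 + 4 * (- R) = - (e\<^sup>2 + d\<^sup>2 - e'\<^sup>2 - d'\<^sup>2 + 4 * R)" by simp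
    then have "(e'\<^sup>2 + d'\<^sup>2 - e\<^sup>2 - d\<^sup>2 + 4 * (- R))\<^sup>2 = (e\<^sup>2 + d\<^sup>2 - e'\<^sup>2 - d'\<^sup>2 + 4 * R)\<^sup>2"
      by (simp only: power2_minus)
    moreover have "((e' + d')\<^sup>2 - (e + d)\<^sup>2) * ((e' - d')\<^sup>2 - (e - d)\<^sup>2) =
      ((e + d)\<^sup>2 - (e' + d')\<^sup>2) * ((e - d)\<^sup>2 - (e' - d')\<^sup>2)" by (simp add: algebra_simps)
    ultimately show ?thesis using D1 by simp
  qed
  have N': "N = (e' + d' + e + d + 2 * S)\<^sup>2 + 2 * (e' * d' + e * d + 2 * T)\<^sup>2"
    unfolding N by (simp add: algebra_simps)
  have odd: "[D = 1] (mod 8) \<or> [D = 5] (mod 8) \<and> N mod 8 = 3" if "odd (e + d + e' + d')"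
  proof (cases "odd (e + d)")
    case True
    then show ?thesis using reduced_value_odd[OF N D1] that by simp
  next
    case False
    then show ?thesis using reduced_value_odd[OF N' D2] that by simp
  qed
  have even: "2 ^ 10 dvd D" if "even (e + d + e' + d')"
    using reduced_value_even[OF N HOL.refl D1 that] .
  have odd_D: "odd D" if "odd (e + d + e' + d')"
    using odd[OF that] unfolding cong_def by presburger
  show "2 ^ 10 dvd sd16_det f g" if "even (sd16_det f g)"
    using that even odd_D unfolding D_def by blast
  show "[sd16_det f g = 1] (mod 8) \<or> [sd16_det f g = 5] (mod 8) \<and>
      (\<exists>m p. [m = 5] (mod 8) \<and> prime p \<and> [p = 3] (mod 8) \<and> sd16_det f g = m * p\<^sup>2)"
    if "odd (sd16_det f g)"
  proof -
    have "\<not> even (e + d + e' + d')"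
      using even that unfolding D_def[symmetric] by (meson dvd_power dvd_trans zero_less_numeral)
    from odd[OF this] show ?thesis
    proof
      assume D5: "[D = 5] (mod 8) \<and> N mod 8 = 3"
      then obtain p where p: "prime p" "p mod 8 = 3" "p dvd N"
        using form_3_mod_8_prime_divisor unfolding N by blast
      then have "p\<^sup>2 dvd N\<^sup>2" by (simp add: dvd_power_same)
      then have "p\<^sup>2 dvd D" unfolding D1 by simp
      then obtain m where m: "D = m * p\<^sup>2" by (metis dvdE mult.commute)
      \<comment> \<open>Removing a square that is 1 modulo 8 leaves the cofactor \<open>m\<close> in
        the class of \<open>D\<close>.\<close>
      have "p\<^sup>2 mod 8 = 1" using p(2) odd_square_mod_8 odd_if_mod_8_eq_3 by blast
      then have "[m * p\<^sup>2 = m * 1] (mod 8)" by (intro cong_mult cong_refl) (simp add: cong_def)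
      then have "[m = 5] (mod 8)" using D5 m by (simp add: cong_def)
      then show ?thesis using D5 m p by (auto simp: D_def cong_def)
    qed (simp add: D_def)
  qed
qed

text \<open>For the element \<open>1 + h(X) (1 + Y)\<close> the quadratic terms cancel in every factor, and the
  factors can be prescribed almost independently.\<close>

lemma sd16_det_one_plus:
  "sd16_det (\<lambda>i. h i + (if i = 0 then 1 else 0)) h =
    (1 + 2 * (h 0 + h 1 + h 2 + h 3 + h 4 + h 5 + h 6 + h 7)) *
    (1 + 2 * (h 0 - h 1 + h 2 - h 3 + h 4 - h 5 + h 6 - h 7)) *
    (1 + 2 * (h 0 - h 2 + h 4 - h 6))\<^sup>2 *
    ((1 + 2 * (h 0 - h 4))\<^sup>2 + 2 * (h 1 - h 5 + h 3 - h 7)\<^sup>2)\<^sup>2"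
proof -
  let ?f = "\<lambda>i. h i + (if i = 0 then 1 else 0)"
  have "(?f 0 + ?f 1 + ?f 2 + ?f 3 + ?f 4 + ?f 5 + ?f 6 + ?f 7)\<^sup>2 -
      (h 0 + h 1 + h 2 + h 3 + h 4 + h 5 + h 6 + h 7)\<^sup>2 =
      1 + 2 * (h 0 + h 1 + h 2 + h 3 + h 4 + h 5 + h 6 + h 7)"
    by (simp add: power2_eq_square algebra_simps)
  moreover have "(?f 0 - ?f 1 + ?f 2 - ?f 3 + ?f 4 - ?f 5 + ?f 6 - ?f 7)\<^sup>2 -
      (h 0 - h 1 + h 2 - h 3 + h 4 - h 5 + h 6 - h 7)\<^sup>2 =
      1 + 2 * (h 0 - h 1 + h 2 - h 3 + h 4 - h 5 + h 6 - h 7)"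
    by (simp add: power2_eq_square algebra_simps)
  moreover have "(?f 0 - ?f 2 + ?f 4 - ?f 6)\<^sup>2 + (?f 1 - ?f 3 + ?f 5 - ?f 7)\<^sup>2 -
      (h 0 - h 2 + h 4 - h 6)\<^sup>2 - (h 1 - h 3 + h 5 - h 7)\<^sup>2 = 1 + 2 * (h 0 - h 2 + h 4 - h 6)"
    by (simp add: power2_eq_square algebra_simps)
  moreover have "sd16_norm_A ?f - sd16_norm_A h = 1 + 2 * (h 0 - h 4)"
    by (simp add: sd16_norm_A_def power2_eq_square algebra_simps)
  moreover have "sd16_norm_B ?f - sd16_norm_B h = h 1 - h 5 + h 3 - h 7"
    by (simp add: sd16_norm_B_def algebra_simps)
  ultimately show ?thesis
    unfolding sd16_det_def by (simp only:)
qed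

section \<open>Realising the admissible values\<close>

lemma sd16_det_1_mod_8: "\<exists>f g. sd16_det f g = 8 * k + 1"
proof -
  \<comment> \<open>Splitting \<open>k\<close> into nearly equal halves makes
    \<open>1 + 2 * (j - l)\<close> equal to 1 or -1.\<close>
  define j where "j = k div 2"
  have "k = 2 * j \<or> k = 2 * j + 1" unfolding j_def by presburger
  then obtain l where l: "k = j + l" and jl: "(1 + 2 * (j - l))\<^sup>2 = 1" by (auto simp: algebra_simps)
  \<comment> \<open>The sum is \<open>4 * k\<close>; the alternating sum, the third linear form and
    the \<open>B\<close> term vanish.\<close>
  let ?h = "\<lambda>i. [j, k, k, 0, l, k, 0, 0] ! i"
  have "sd16_det (\<lambda>i. ?h i + (if i = 0 then 1 else 0)) ?h = 8 * k + 1"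
    unfolding sd16_det_one_plus using jl by (simp add: l)
  then show ?thesis by blast
qed

lemma sd16_det_5_mod_8: 
  assumes "[m = 5] (mod 8)" "prime p" "[p = 3] (mod 8)"
  shows "\<exists>f g. sd16_det f g = m * p\<^sup>2"
proof -
  obtain A B where AB: "p = A\<^sup>2 + 2 * B\<^sup>2"
    using prime_3_mod_8_form[OF assms(2)] assms(3) by (auto simp: cong_def)
  have p8: "p mod 8 = 3" using assms(3) by (simp add: cong_def)
  then have oddp: "odd (A\<^sup>2 + 2 * B\<^sup>2)" using odd_if_mod_8_eq_3 AB by blast
  have "odd B"
  proof (rule ccontr)
    assume "\<not> odd B"
    then have "p mod 8 = 1" using odd_form_mod_8[OF oddp] AB by simp
    then show False using p8 by simp
  qed
  then obtain b where b: "B = 2 * b + 1" by (elim oddE)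
  have "odd A" using oddp by simp
  then obtain q where q: "A = 2 * q + 1" by (elim oddE)
  have "8 dvd m - 5" using assms(1) by (simp add: cong_iff_dvd_diff)
  then obtain l where l: "m - 5 = 8 * l" by (elim dvdE)
  \<comment> \<open>Replacing \<open>A\<close> by \<open>-A\<close> changes \<open>q\<close> to
    \<open>- q - 1\<close>, of opposite parity. The parity must match \<open>l\<close> so that
    \<open>h 0 + h 4 = l\<close> and \<open>h 0 - h 4 = t\<close> have an integer solution.\<close>
  obtain t where t: "(1 + 2 * t)\<^sup>2 = A\<^sup>2" "even (l - t)"
  proof (cases "even (l - q)")
    case True
    then show ?thesis using that[of q] by (simp add: q add.commute)
  next
    case False
    then show ?thesis using that[of "- q - 1"] by (simp add: q power2_eq_square algebra_simps)
  qed
  then obtain s where s: "l = 2 * s + t" by (elim evenE) (simp add: algebra_simps)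
  \<comment> \<open>The sum is \<open>4 * l + 2\<close>, giving the factor
    \<open>8 * l + 5 = m\<close>; the next two factors become 1 and -1, and the last form becomes
    \<open>A^2 + 2 * B^2 = p\<close>.\<close>
  let ?h = "\<lambda>i. [s + t, l + b + 1, l + 1, 0, s, l - b, 0, 0] ! i"
  have "sd16_det (\<lambda>i. ?h i + (if i = 0 then 1 else 0)) ?h = m * p\<^sup>2"
  proof -
    have "1 + 2 * (?h 0 + ?h 1 + ?h 2 + ?h 3 + ?h 4 + ?h 5 + ?h 6 + ?h 7) = m"
      using l s by simp
    moreover have "1 + 2 * (?h 0 - ?h 1 + ?h 2 - ?h 3 + ?h 4 - ?h 5 + ?h 6 - ?h 7) = 1"
      using s by simp
    moreover have "1 + 2 * (?h 0 - ?h 2 + ?h 4 - ?h 6) = -1"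
      using s by simp
    moreover have "?h 0 - ?h 4 = t" by simp
    moreover have "?h 1 - ?h 5 + ?h 3 - ?h 7 = B" using b by simp
    ultimately show ?thesis
      unfolding sd16_det_one_plus by (simp only: t(1) AB) simp
  qed
  then show ?thesis by blast
qed

text \<open>Adding \<open>k\<close> to all coefficients changes only the linear factor \<open>f(1) + g(1)\<close>, by \<open>16 k\<close>. The four
  coefficient vectors, found by search, have the other factors multiplying to \<open>2^8\<close> and
  \<open>f(1) + g(1)\<close> equal to 0, 4, 8 and -4.\<close>

lemma sd16_det_multiple_1024: "\<exists>f g. sd16_det f g = 2 ^ 10 * n"
proof -
  define k where "k = n div 4"
  \<comment> \<open>The residue 3 is written as -1 because the fourth vector has
    \<open>f(1) + g(1) = -4\<close>.\<close>
  have "n = 4 * k \<or> n = 4 * k + 1 \<or> n = 4 * k + 2 \<or> n = 4 * (k + 1) - 1"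
    unfolding k_def by presburger
  moreover have "sd16_det (\<lambda>i. [-1, 0, 0, 0, 0, -1, 0, 0] ! i + k)
        (\<lambda>i. [0, 0, 0, 1, 0, 0, 0, 1] ! i + k) =
      2 ^ 10 * (4 * k)" for k
    by (simp add: sd16_det_def sd16_norm_A_def sd16_norm_B_def power2_eq_square algebra_simps)
  moreover have "sd16_det (\<lambda>i. k) (\<lambda>i. [1, 1, 0, 0, 1, 0, 1, 0] ! i + k) =
      2 ^ 10 * (4 * k + 1)" for k
    by (simp add: sd16_det_def sd16_norm_A_def sd16_norm_B_def power2_eq_square algebra_simps)
  moreover have "sd16_det (\<lambda>i. [0, 0, 1, 0, 0, 0, 0, 1] ! i + k)
        (\<lambda>i. [0, 1, 2, 0, 1, 0, 1, 1] ! i + k) =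
      2 ^ 10 * (4 * k + 2)" for k
    by (simp add: sd16_det_def sd16_norm_A_def sd16_norm_B_def power2_eq_square algebra_simps)
  moreover have "sd16_det (\<lambda>i. [0, 0, 0, 0, 0, 1, -1, 0] ! i + k)
        (\<lambda>i. [-1, -1, 0, -1, 0, 0, -1, 0] ! i + k) =
      2 ^ 10 * (4 * k - 1)" for k
    by (simp add: sd16_det_def sd16_norm_A_def sd16_norm_B_def power2_eq_square algebra_simps)
  ultimately show ?thesis by metis
qed

theorem mainTheorem1:
  shows "{n \<in> integer_group_determinants SD16. even n} = {n. 2 ^ 10 dvd n} \<and>
    {n \<in> integer_group_determinants SD16. odd n} =
      {n. [n = 1] (mod 8)} \<union>
      {n. [n = 5] (mod 8) \<and>
          (\<exists>m p :: int. [m = 5] (mod 8) \<and> prime p \<and> [p = 3] (mod 8) \<and> n = m * p ^ 2)}"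
proof (intro conjI equalityI subsetI)
  fix n assume "n \<in> {n \<in> integer_group_determinants SD16. even n}"
  then show "n \<in> {n. 2 ^ 10 dvd n}"
    using sd16_det_even by (auto simp: integer_group_determinants_SD16)
next
  fix n :: int assume "n \<in> {n. 2 ^ 10 dvd n}"
  then obtain k where n: "n = 2 ^ 10 * k" by (auto elim: dvdE)
  then have "even n" by simp
  then show "n \<in> {n \<in> integer_group_determinants SD16. even n}"
    using sd16_det_multiple_1024[of k] n by (auto simp: integer_group_determinants_SD16) metis
next
  fix n assume "n \<in> {n \<in> integer_group_determinants SD16. odd n}"
  then obtain f g where "n = sd16_det f g" "odd (sd16_det f g)"
    by (auto simp: integer_group_determinants_SD16)
  then show "n \<in> {n. [n = 1] (mod 8)} \<union> {n. [n = 5] (mod 8) \<and>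
      (\<exists>m p :: int. [m = 5] (mod 8) \<and> prime p \<and> [p = 3] (mod 8) \<and> n = m * p ^ 2)}"
    using sd16_det_odd[of f g] by blast
next
  fix n assume n: "n \<in> {n. [n = 1] (mod 8)} \<union> {n. [n = 5] (mod 8) \<and>
      (\<exists>m p :: int. [m = 5] (mod 8) \<and> prime p \<and> [p = 3] (mod 8) \<and> n = m * p ^ 2)}"
  then have "odd n" unfolding cong_def by (elim UnE CollectE conjE) presburger+
  moreover have "\<exists>f g. n = sd16_det f g"
    using n
  proof (elim UnE CollectE conjE exE)
    assume "[n = 1] (mod 8)"
    then have "8 dvd n - 1" by (simp add: cong_iff_dvd_diff)
    then obtain k where "n - 1 = 8 * k" by (elim dvdE)
    then have "n = 8 * k + 1" by simp
    then show ?thesis using sd16_det_1_mod_8[of k] by metis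
  next
    fix m p :: int assume "[m = 5] (mod 8)" "prime p" "[p = 3] (mod 8)" "n = m * p ^ 2"
    then show ?thesis using sd16_det_5_mod_8[of m p] by metis
  qed
  ultimately show "n \<in> {n \<in> integer_group_determinants SD16. odd n}"
    by (auto simp: integer_group_determinants_SD16)
qed

end
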